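(* Let $n,d\in A_{0}+AP_{+}$. The following are equivalent: (1) There exist $x,y\in A_{0}+AP_{+}$ such that $nx+dy=1$. (2) There exists $\delta>0$ such that $|n(s)|+|d(s)|\geq\delta>0$ for all $s\in\mathbb{C}_{\geq 0}$.
   Context: $\mathbb{C}_{\geq 0}=\{s\in\mathbb{C}:\operatorname{Re}(s)\geq 0\}$ and $\mathbb{C}_{>0}=\{s\in\mathbb{C}:\operatorname{Re}(s)>0\}$. $A_{0}$ is the set of functions $f:\mathbb{C}_{\geq 0}\to\mathbb{C}$ that are holomorphic in $\mathbb{C}_{>0}$, continuous on $\mathbb{C}_{\geq 0}$, and satisfy $\lim_{s\to\infty}f(s)=0$ (limit as $|s|\to\infty$ in $\mathbb{C}_{\geq 0}$). $AP_{+}$ (causal almost periodic functions) is the closure, in the supremum norm on $\mathbb{C}_{\geq 0}$, of the complex linear span of the functions $s\mapsto e^{-st}$, $t\geq 0$. $A_{0}+AP_{+}=\{f:\mathbb{C}_{\geq 0}\to\mathbb{C}: f=f_{A_0}+f_{AP_+},\ f_{A_0}\in A_0,\ f_{AP_+}\in AP_+\}$ is a Banach algebra with pointwise operations and the supremum norm $\|f\|_\infty=\sup_{s\in\mathbb{C}_{\geq 0}}|f(s)|$. *)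

theory Defs
  imports "HOL-Complex_Analysis.Complex_Analysis"
begin

text \<open>
  A function on the closed right half-plane is represented by a total function on the
  complex numbers whose values outside the half-plane are irrelevant: every condition
  below, including equality of functions, is imposed on the half-plane only.
\<close>

definition closed_rhp :: "complex set" where
  "closed_rhp = {s. Re s \<ge> 0}"

definition open_rhp :: "complex set" where
  "open_rhp = {s. Re s > 0}"

definition A0 :: "(complex \<Rightarrow> complex) set" where
  "A0 = {f. f holomorphic_on open_rhp \<and> continuous_on closed_rhp f \<and>
            (f \<longlongrightarrow> 0) (inf at_infinity (principal closed_rhp))}"

definition exp_span :: "(complex \<Rightarrow> complex) set" where
  "exp_span = {p. \<exists>T c. finite T \<and> T \<subseteq> {0::real..} \<and>
                   p = (\<lambda>s. \<Sum>t\<in>T. c t * exp (- s * complex_of_real t))}"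

text \<open>
  The pointwise bound by \<open>\<epsilon>\<close> on the half-plane says that the supremum norm of \<open>f - p\<close> is
  at most \<open>\<epsilon>\<close>, so the following is the closure in the supremum norm.
\<close>

definition AP_plus :: "(complex \<Rightarrow> complex) set" where
  "AP_plus = {f. \<forall>\<epsilon>>0. \<exists>p\<in>exp_span. \<forall>s\<in>closed_rhp. cmod (f s - p s) \<le> \<epsilon>}"

definition A0_AP_plus :: "(complex \<Rightarrow> complex) set" where
  "A0_AP_plus = {f. \<exists>g\<in>A0. \<exists>h\<in>AP_plus. \<forall>s\<in>closed_rhp. f s = g s + h s}"

end

theory Submission
  imports Defs "HOL-Probability.Sinc_Integral"
begin

text \<open>
  The implication from (1) to (2) holds because elements of the algebra are bounded. The converse is
  a corona theorem, and the proof works with explicit functions instead of maximal ideals: Bezout solutions that exist trivially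
  on single vertical lines are patched together, in the manner of a Cousin problem.

  \<^bold>\<open>The almost periodic part.\<close> On a vertical line \<open>Re s = \<alpha>\<close> the complex conjugate of \<open>e\<^sup>-\<^sup>s\<^sup>t\<close> is a
  multiple of \<open>e\<^sup>s\<^sup>t\<close>, so uniform limits of exponential polynomials with exponents of both signs
  form a C*-algebra there, and \<open>cnj f\<^sub>i / (\<Sum> |f\<^sub>j|\<^sup>2)\<close> solves \<open>\<Sum> f\<^sub>i x\<^sub>i = 1\<close> within it. Replacing the
  solution by an exponential polynomial gives an approximate solution that survives on a thin strip
  around the line (\<open>bezout_on_thin_strip\<close>). Far to the right the functions are nearly constant and a
  constant solves the problem (\<open>bezout_far_right\<close>). A solution on a strip and a solution on a half-plane
  overlapping it differ by an antisymmetric matrix applied to \<open>f\<close>; the matrix entries are split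
  additively into a part for the strip and a causal part for the half-plane, and the
  solution extends to the union (\<open>bezout_patching\<close>). Taking the infimum of the abscissas
  reached in this way shows that the imaginary axis is among them (\<open>exp_corona\<close>).

  Patching needs one quantitative fact: an exponential polynomial that is small on a strip is
  the difference of a polynomial that is small to the left and a causal polynomial that is small
  to the right, with constants independent of the exponents (\<open>exp_poly_splitting\<close>). The polynomial is cut
  into blocks of bounded exponent range by hat functions, whose Fourier transforms are Fejer kernels,
  and the Phragmen-Lindelof principle makes the blocks decay geometrically.

  \<^bold>\<open>The vanishing part.\<close> Write \<open>n = n\<^sub>0 + n\<^sub>A\<close> and \<open>d = d\<^sub>0 + d\<^sub>A\<close>. Almost periods show that \<open>n\<^sub>A\<close> and \<open>d\<^sub>A\<close>
  inherit the lower bound, so \<open>n\<^sub>A x\<^sub>A + d\<^sub>A y\<^sub>A = 1\<close> is solvable and \<open>n x\<^sub>A + d y\<^sub>A = 1 + h\<close> with \<open>h\<close> vanishing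
  at infinity. With \<open>z = 1 / (s + 1)\<close>, the three functions \<open>1 + h\<close>, \<open>n z\<close>, \<open>d z\<close> lie in
  \<open>A\<^sub>0 + \<complex>\<close>, which is the disc algebra in disguise, and they are jointly bounded below. A Bezout
  identity for them yields one for \<open>n\<close> and \<open>d\<close> (\<open>A0_AP_plus_corona\<close>). The disc algebra itself
  consists of the uniform limits of exponential polynomials with \<^emph>\<open>nonnegative integer\<close> exponents, read through
  \<open>w = e\<^sup>-\<^sup>s\<close>, so the corona theorem of the first part applies to it as well: this is why
  exponents are taken from an arbitrary subgroup of the reals, and why any finite number
  of functions is allowed.
\<close>

section \<open>Exponential polynomials and their uniform closures\<close>

definition exp_polys :: "real set \<Rightarrow> (complex \<Rightarrow> complex) set" where
  "exp_polys G = {p. \<exists>T c. finite T \<and> T \<subseteq> G \<and>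
                    p = (\<lambda>s. \<Sum>t\<in>T. c t * exp (- s * complex_of_real t))}"

lemma exp_span_eq_exp_polys: "exp_span = exp_polys {0..}"
  by (simp add: exp_span_def exp_polys_def)

lemma exp_polysI:
  assumes "finite T" "T \<subseteq> G" "\<And>s. p s = (\<Sum>t\<in>T. c t * exp (- s * complex_of_real t))"
  shows "p \<in> exp_polys G"
  using assms unfolding exp_polys_def by blast

lemma exp_polysE:
  assumes "p \<in> exp_polys G"
  obtains T c where "finite T" "T \<subseteq> G" "\<And>s. p s = (\<Sum>t\<in>T. c t * exp (- s * complex_of_real t))"
  using assms unfolding exp_polys_def by blast

lemma exp_polys_mono: "p \<in> exp_polys G \<Longrightarrow> G \<subseteq> H \<Longrightarrow> p \<in> exp_polys H"
  by (auto elim!: exp_polysE intro!: exp_polysI)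

lemma exp_polys_monomial: "t \<in> G \<Longrightarrow> (\<lambda>s. c * exp (- s * complex_of_real t)) \<in> exp_polys G"
  by (rule exp_polysI[of "{t}" _ _ "\<lambda>_. c"]) auto

lemma exp_polys_add:
  assumes "p \<in> exp_polys G" "q \<in> exp_polys G"
  shows "(\<lambda>s. p s + q s) \<in> exp_polys G"
proof -
  obtain T c where T: "finite T" "T \<subseteq> G" "\<And>s. p s = (\<Sum>t\<in>T. c t * exp (- s * complex_of_real t))"
    using assms(1) by (rule exp_polysE) blast
  obtain U d where U: "finite U" "U \<subseteq> G" "\<And>s. q s = (\<Sum>t\<in>U. d t * exp (- s * complex_of_real t))"
    using assms(2) by (rule exp_polysE) blast
  have "p s + q s = (\<Sum>t\<in>T \<union> U. ((if t \<in> T then c t else 0) + (if t \<in> U then d t else 0))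
          * exp (- s * complex_of_real t))" for s
  proof -
    have "p s = (\<Sum>t\<in>T \<union> U. (if t \<in> T then c t else 0) * exp (- s * complex_of_real t))"
      unfolding T(3) using T(1) U(1) by (intro sum.mono_neutral_cong_left) auto
    moreover have "q s = (\<Sum>t\<in>T \<union> U. (if t \<in> U then d t else 0) * exp (- s * complex_of_real t))"
      unfolding U(3) using T(1) U(1) by (intro sum.mono_neutral_cong_left) auto
    ultimately show ?thesis by (simp add: sum.distrib distrib_right)
  qed
  then show ?thesis using T U by (intro exp_polysI[of "T \<union> U"]) auto
qed

lemma exp_polys_sum:
  assumes "finite I" "\<And>i. i \<in> I \<Longrightarrow> p i \<in> exp_polys G"
  shows "(\<lambda>s. \<Sum>i\<in>I. p i s) \<in> exp_polys G"
  using assms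
proof (induction I rule: finite_induct)
  case empty
  show ?case by (rule exp_polysI[of "{}"]) auto
next
  case (insert i I)
  then show ?case by (simp add: exp_polys_add)
qed

lemma exp_polys_mult:
  assumes "p \<in> exp_polys G" "q \<in> exp_polys G" and G: "\<And>t u. t \<in> G \<Longrightarrow> u \<in> G \<Longrightarrow> t + u \<in> G"
  shows "(\<lambda>s. p s * q s) \<in> exp_polys G"
proof -
  obtain T c where T: "finite T" "T \<subseteq> G" "\<And>s. p s = (\<Sum>t\<in>T. c t * exp (- s * complex_of_real t))"
    using assms(1) by (rule exp_polysE) blast
  obtain U d where U: "finite U" "U \<subseteq> G" "\<And>s. q s = (\<Sum>t\<in>U. d t * exp (- s * complex_of_real t))"
    using assms(2) by (rule exp_polysE) blast
  have "p s * q s = (\<Sum>t\<in>T. \<Sum>u\<in>U. (c t * d u) * exp (- s * complex_of_real (t + u)))" for s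
    unfolding T(3) U(3) sum_product by (simp add: exp_add algebra_simps exp_diff exp_minus field_simps)
  moreover have "(\<lambda>s. \<Sum>t\<in>T. \<Sum>u\<in>U. (c t * d u) * exp (- s * complex_of_real (t + u))) \<in> exp_polys G"
    using T(1,2) U(1,2) by (intro exp_polys_sum exp_polys_monomial G) auto
  ultimately show ?thesis by simp
qed

definition rhp :: "real \<Rightarrow> complex set" where
  "rhp a = {s. a \<le> Re s}"

definition vstrip :: "real \<Rightarrow> real \<Rightarrow> complex set" where
  "vstrip a b = {s. a \<le> Re s \<and> Re s \<le> b}"

definition unif_closure :: "complex set \<Rightarrow> (complex \<Rightarrow> complex) set \<Rightarrow> (complex \<Rightarrow> complex) set" where
  "unif_closure S E = {f. \<forall>\<epsilon>>0. \<exists>p\<in>E. \<forall>s\<in>S. cmod (f s - p s) \<le> \<epsilon>}"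

lemma unif_closureD:
  assumes "f \<in> unif_closure S E" "\<epsilon> > 0"
  obtains p where "p \<in> E" "\<And>s. s \<in> S \<Longrightarrow> cmod (f s - p s) \<le> \<epsilon>"
  using assms unfolding unif_closure_def by blast

lemma unif_closureI:
  assumes "\<And>\<epsilon>. \<epsilon> > 0 \<Longrightarrow> \<exists>p\<in>E. \<forall>s\<in>S. cmod (f s - p s) \<le> \<epsilon>"
  shows "f \<in> unif_closure S E"
  using assms unfolding unif_closure_def by blast

lemma unif_closure_mono:
  assumes "f \<in> unif_closure S E" "S' \<subseteq> S" "E \<subseteq> E'"
  shows "f \<in> unif_closure S' E'"
  using assms unfolding unif_closure_def by blast

lemma subset_unif_closure: "p \<in> E \<Longrightarrow> p \<in> unif_closure S E"
  by (rule unif_closureI) (auto intro!: bexI[of _ p])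

lemma unif_closure_cong:
  assumes "f \<in> unif_closure S E" "\<And>s. s \<in> S \<Longrightarrow> f s = g s"
  shows "g \<in> unif_closure S E"
  using assms unfolding unif_closure_def by simp

text \<open>
  The uniform closure of an algebra of functions that are bounded on \<open>S\<close> is a Banach algebra, in which
  elements near \<open>1\<close> are invertible. The functions are total but are controlled on \<open>S\<close> alone, so that
  the same exponential polynomials can be closed over strips, lines and half-planes.
\<close>

locale bounded_algebra =
  fixes S :: "complex set" and E :: "(complex \<Rightarrow> complex) set"
  assumes const: "(\<lambda>s. c) \<in> E"
    and add: "p \<in> E \<Longrightarrow> q \<in> E \<Longrightarrow> (\<lambda>s. p s + q s) \<in> E"
    and mult: "p \<in> E \<Longrightarrow> q \<in> E \<Longrightarrow> (\<lambda>s. p s * q s) \<in> E"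
    and bounded: "p \<in> E \<Longrightarrow> \<exists>B. \<forall>s\<in>S. cmod (p s) \<le> B"
begin

lemma closure_bounded:
  assumes "f \<in> unif_closure S E"
  obtains B where "B > 0" "\<And>s. s \<in> S \<Longrightarrow> cmod (f s) \<le> B"
proof -
  obtain p where p: "p \<in> E" "\<And>s. s \<in> S \<Longrightarrow> cmod (f s - p s) \<le> 1"
    using unif_closureD[OF assms zero_less_one] by metis
  obtain B where B: "\<And>s. s \<in> S \<Longrightarrow> cmod (p s) \<le> B" using bounded[OF p(1)] by metis
  have "cmod (f s) \<le> \<bar>B\<bar> + 1" if "s \<in> S" for s
    using norm_triangle_ineq[of "f s - p s" "p s"] p(2)[OF that] B[OF that] by simp
  then show thesis by (intro that[of "\<bar>B\<bar> + 1"]) auto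
qed

lemma closure_const: "(\<lambda>s. c) \<in> unif_closure S E"
  by (intro subset_unif_closure const)

lemma closure_add:
  assumes f: "f \<in> unif_closure S E" and g: "g \<in> unif_closure S E"
  shows "(\<lambda>s. f s + g s) \<in> unif_closure S E"
proof (rule unif_closureI)
  fix \<epsilon> :: real assume "\<epsilon> > 0"
  then have e2: "\<epsilon> / 2 > 0" by simp
  obtain p where p: "p \<in> E" "\<And>s. s \<in> S \<Longrightarrow> cmod (f s - p s) \<le> \<epsilon> / 2"
    using unif_closureD[OF f e2] by metis
  obtain q where q: "q \<in> E" "\<And>s. s \<in> S \<Longrightarrow> cmod (g s - q s) \<le> \<epsilon> / 2"
    using unif_closureD[OF g e2] by metis
  have "cmod (f s + g s - (p s + q s)) \<le> \<epsilon>" if "s \<in> S" for s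
    using norm_diff_triangle_ineq[of "f s" "g s" "p s" "q s"] p(2)[OF that] q(2)[OF that] by simp
  then show "\<exists>p\<in>E. \<forall>s\<in>S. cmod (f s + g s - p s) \<le> \<epsilon>"
    using add[OF p(1) q(1)] by (intro bexI[of _ "\<lambda>s. p s + q s"]) auto
qed

lemma closure_mult:
  assumes f: "f \<in> unif_closure S E" and g: "g \<in> unif_closure S E"
  shows "(\<lambda>s. f s * g s) \<in> unif_closure S E"
proof (rule unif_closureI)
  fix \<epsilon> :: real assume \<epsilon>: "\<epsilon> > 0"
  obtain B where B: "B > 0" "\<And>s. s \<in> S \<Longrightarrow> cmod (g s) \<le> B" using closure_bounded[OF g] by metis
  have "\<epsilon> / (2 * B) > 0" using \<epsilon> B by simp
  then obtain p where p: "p \<in> E" "\<And>s. s \<in> S \<Longrightarrow> cmod (f s - p s) \<le> \<epsilon> / (2 * B)"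
    using unif_closureD[OF f] by metis
  obtain C where C: "C > 0" "\<And>s. s \<in> S \<Longrightarrow> cmod (p s) \<le> C"
    using closure_bounded[OF subset_unif_closure[OF p(1)]] by metis
  have "\<epsilon> / (2 * C) > 0" using \<epsilon> C by simp
  then obtain q where q: "q \<in> E" "\<And>s. s \<in> S \<Longrightarrow> cmod (g s - q s) \<le> \<epsilon> / (2 * C)"
    using unif_closureD[OF g] by metis
  have "cmod (f s * g s - p s * q s) \<le> \<epsilon>" if s: "s \<in> S" for s
  proof -
    have "f s * g s - p s * q s = (f s - p s) * g s + p s * (g s - q s)"
      by (simp add: algebra_simps)
    then have "cmod (f s * g s - p s * q s) \<le> cmod (f s - p s) * cmod (g s) + cmod (p s) * cmod (g s - q s)"
      by (metis norm_mult norm_triangle_ineq)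
    also have "\<dots> \<le> \<epsilon> / (2 * B) * B + C * (\<epsilon> / (2 * C))"
      using p(2)[OF s] B(2)[OF s] C(2)[OF s] q(2)[OF s] \<epsilon> B(1) C(1)
      by (intro add_mono mult_mono) auto
    also have "\<dots> = \<epsilon>" using B(1) C(1) by simp
    finally show ?thesis .
  qed
  then show "\<exists>p\<in>E. \<forall>s\<in>S. cmod (f s * g s - p s) \<le> \<epsilon>"
    using mult[OF p(1) q(1)] by (intro bexI[of _ "\<lambda>s. p s * q s"]) auto
qed

lemma closure_cmult: "f \<in> unif_closure S E \<Longrightarrow> (\<lambda>s. c * f s) \<in> unif_closure S E"
  by (rule closure_mult[OF closure_const])

lemma closure_diff:
  "f \<in> unif_closure S E \<Longrightarrow> g \<in> unif_closure S E \<Longrightarrow> (\<lambda>s. f s - g s) \<in> unif_closure S E"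
  using closure_add[OF _ closure_cmult[of g "- 1"]] by simp

lemma closure_sum:
  assumes "finite I" "\<And>i. i \<in> I \<Longrightarrow> f i \<in> unif_closure S E"
  shows "(\<lambda>s. \<Sum>i\<in>I. f i s) \<in> unif_closure S E"
  using assms by (induction I rule: finite_induct) (simp_all add: closure_add closure_const)

lemma closure_power: "f \<in> unif_closure S E \<Longrightarrow> (\<lambda>s. f s ^ k) \<in> unif_closure S E"
  by (induction k) (simp_all add: closure_mult closure_const)

lemma closure_limit:
  assumes "\<And>\<epsilon>. \<epsilon> > 0 \<Longrightarrow> \<exists>g\<in>unif_closure S E. \<forall>s\<in>S. cmod (f s - g s) \<le> \<epsilon>"
  shows "f \<in> unif_closure S E"
proof (rule unif_closureI)
  fix \<epsilon> :: real assume "\<epsilon> > 0"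
  then have e2: "\<epsilon> / 2 > 0" by simp
  obtain g where g: "g \<in> unif_closure S E" "\<And>s. s \<in> S \<Longrightarrow> cmod (f s - g s) \<le> \<epsilon> / 2"
    using assms[OF e2] by metis
  obtain p where p: "p \<in> E" "\<And>s. s \<in> S \<Longrightarrow> cmod (g s - p s) \<le> \<epsilon> / 2"
    using unif_closureD[OF g(1) e2] by metis
  have "cmod (f s - p s) \<le> \<epsilon>" if "s \<in> S" for s
    using norm_triangle_ineq[of "f s - g s" "g s - p s"] g(2)[OF that] p(2)[OF that] by simp
  then show "\<exists>p\<in>E. \<forall>s\<in>S. cmod (f s - p s) \<le> \<epsilon>" using p(1) by blast
qed

text \<open>
  Neumann series: the partial sums of \<open>\<Sum> (1 - f)\<^sup>k\<close> lie in the closure and converge uniformly to \<open>1 / f\<close>.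
\<close>

lemma closure_inverse:
  assumes f: "f \<in> unif_closure S E" and r: "r < 1" "\<And>s. s \<in> S \<Longrightarrow> cmod (f s - 1) \<le> r"
  shows "(\<lambda>s. 1 / f s) \<in> unif_closure S E"
proof (cases "S = {}")
  case True
  then show ?thesis using unif_closure_cong[OF closure_const] by blast
next
  case False
  then have r0: "0 \<le> r" using r(2) by (meson all_not_in_conv norm_ge_zero order_trans)
  show ?thesis
  proof (rule closure_limit)
    fix \<epsilon> :: real assume "\<epsilon> > 0"
    then have "\<epsilon> * (1 - r) > 0" using r by simp
    then obtain N where N: "r ^ N < \<epsilon> * (1 - r)" using real_arch_pow_inv[of _ r] r(1) by blast
    define g where "g s = (\<Sum>k<N. (1 - f s) ^ k)" for s
    have "g \<in> unif_closure S E" unfolding g_def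
      by (intro closure_sum closure_power closure_diff closure_const f finite_lessThan)
    moreover have "cmod (1 / f s - g s) \<le> \<epsilon>" if s: "s \<in> S" for s
    proof -
      have fs: "cmod (f s) \<ge> 1 - r"
        using norm_triangle_ineq2[of 1 "1 - f s"] r(2)[OF s] by (simp add: norm_minus_commute)
      then have f0: "f s \<noteq> 0" using r(1) by auto
      have "g s = (1 - (1 - f s) ^ N) / f s" unfolding g_def
        using f0 sum_gp_strict[of "1 - f s" N] by simp
      then have "1 / f s - g s = (1 - f s) ^ N / f s" by (simp add: diff_divide_distrib)
      then have "cmod (1 / f s - g s) = cmod (f s - 1) ^ N / cmod (f s)"
        by (simp add: norm_divide norm_power norm_minus_commute)
      also have "\<dots> \<le> r ^ N / (1 - r)"
        using r(1) fs r(2)[OF s] by (intro frac_le power_mono) (auto simp: r0)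
      also have "\<dots> \<le> \<epsilon>" using N r(1) by (simp add: field_simps)
      finally show ?thesis .
    qed
    ultimately show "\<exists>g\<in>unif_closure S E. \<forall>s\<in>S. cmod (1 / f s - g s) \<le> \<epsilon>" by blast
  qed
qed

end

lemma norm_exp_mult_real: "cmod (exp (- s * complex_of_real t)) = exp (- Re s * t)"
  by simp

lemma exp_polys_bounded_vstrip:
  assumes "p \<in> exp_polys G"
  shows "\<exists>B. \<forall>s\<in>vstrip a b. cmod (p s) \<le> B"
proof -
  obtain T c where T: "finite T" "\<And>s. p s = (\<Sum>t\<in>T. c t * exp (- s * complex_of_real t))"
    using assms by (rule exp_polysE) blast
  have "cmod (p s) \<le> (\<Sum>t\<in>T. cmod (c t) * exp ((\<bar>a\<bar> + \<bar>b\<bar>) * \<bar>t\<bar>))" if "s \<in> vstrip a b" for s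
    unfolding T(2)
  proof (rule sum_norm_le)
    fix t
    have "- Re s * t \<le> \<bar>Re s\<bar> * \<bar>t\<bar>" by (metis abs_ge_self abs_minus_cancel abs_mult)
    also have "\<dots> \<le> (\<bar>a\<bar> + \<bar>b\<bar>) * \<bar>t\<bar>"
      using that by (intro mult_right_mono) (auto simp: vstrip_def)
    finally show "cmod (c t * exp (- s * complex_of_real t)) \<le> cmod (c t) * exp ((\<bar>a\<bar> + \<bar>b\<bar>) * \<bar>t\<bar>)"
      by (simp add: norm_mult mult_left_mono)
  qed
  then show ?thesis by blast
qed

lemma exp_polys_bounded_rhp:
  assumes "p \<in> exp_polys G" "G \<subseteq> {0..}"
  shows "\<exists>B. \<forall>s\<in>rhp a. cmod (p s) \<le> B"
proof -
  obtain T c where T: "finite T" "T \<subseteq> G" "\<And>s. p s = (\<Sum>t\<in>T. c t * exp (- s * complex_of_real t))"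
    using assms(1) by (rule exp_polysE) blast
  have "cmod (p s) \<le> (\<Sum>t\<in>T. cmod (c t) * exp (- a * t))" if "s \<in> rhp a" for s
    unfolding T(3)
  proof (rule sum_norm_le)
    fix t assume "t \<in> T"
    then have "a * t \<le> Re s * t"
      using that T assms(2) by (intro mult_right_mono) (auto simp: rhp_def)
    then show "cmod (c t * exp (- s * complex_of_real t)) \<le> cmod (c t) * exp (- a * t)"
      by (simp add: norm_mult mult_left_mono)
  qed
  then show ?thesis by blast
qed

lemma exp_polys_const: "0 \<in> G \<Longrightarrow> (\<lambda>s. c) \<in> exp_polys G"
  using exp_polys_monomial[of 0 G c] by simp

lemma exp_polys_minus:
  assumes "p \<in> exp_polys G"
  shows "(\<lambda>s. - p s) \<in> exp_polys G"
proof -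
  obtain T c where T: "finite T" "T \<subseteq> G" "\<And>s. p s = (\<Sum>t\<in>T. c t * exp (- s * complex_of_real t))"
    using assms by (rule exp_polysE) blast
  show ?thesis
    by (rule exp_polysI[OF T(1,2), of _ "\<lambda>t. - c t"]) (simp add: T(3) sum_negf)
qed

lemma exp_polys_diff:
  "p \<in> exp_polys G \<Longrightarrow> q \<in> exp_polys G \<Longrightarrow> (\<lambda>s. p s - q s) \<in> exp_polys G"
  using exp_polys_add[OF _ exp_polys_minus[of q]] by simp


section \<open>The Fejer kernel as a Fourier multiplier\<close>

definition hat :: "real \<Rightarrow> real" where
  "hat x = max 0 (1 - \<bar>x\<bar>)"

definition ramp :: "real \<Rightarrow> real" where
  "ramp x = min 1 (max 0 x)"

lemma hat_eq_ramp_diff: "hat x = ramp (x + 1) - ramp x"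
  by (auto simp: hat_def ramp_def min_def max_def)

lemma hat_second_difference: "2 * hat x = \<bar>x + 1\<bar> + \<bar>x - 1\<bar> - 2 * \<bar>x\<bar>"
  by (auto simp: hat_def max_def abs_if)

lemma hat_nonneg: "0 \<le> hat x" and hat_le_1: "hat x \<le> 1"
  by (auto simp: hat_def)

text \<open>
  For \<open>x = 1\<close> this is the Fejer kernel up to normalisation. The parameter \<open>x\<close> is there
  because all these functions are dilates of one another.
\<close>

definition fejer :: "real \<Rightarrow> real \<Rightarrow> real" where
  "fejer x u = (1 - cos (x * u)) / u\<^sup>2"

lemma fejer_nonneg: "0 \<le> fejer x u"
  by (simp add: fejer_def)

lemma one_minus_cos_le: "1 - cos (x::real) \<le> x\<^sup>2 / 2"
proof -
  have "1 - cos x = 2 * (sin (x / 2))\<^sup>2"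
    using cos_double_sin[of "x / 2"] by simp
  moreover have "(sin (x / 2))\<^sup>2 \<le> (x / 2)\<^sup>2"
    using abs_sin_x_le_abs_x[of "x / 2"] by (metis abs_le_square_iff)
  ultimately show ?thesis by (simp add: power2_eq_square)
qed

lemma fejer_le: "fejer x u \<le> (2 + x\<^sup>2 / 2) * inverse (1 + u\<^sup>2)"
proof (cases "u = 0")
  case False
  have "(1 - cos (x * u)) * (1 + u\<^sup>2) = (1 - cos (x * u)) + (1 - cos (x * u)) * u\<^sup>2"
    by (simp add: algebra_simps)
  also have "\<dots> \<le> (x * u)\<^sup>2 / 2 + 2 * u\<^sup>2"
    using one_minus_cos_le[of "x * u"] cos_ge_minus_one[of "x * u"]
    by (intro add_mono mult_right_mono) auto
  also have "\<dots> = (2 + x\<^sup>2 / 2) * u\<^sup>2" by (simp add: power_mult_distrib algebra_simps)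
  finally have "(1 - cos (x * u)) * (1 + u\<^sup>2) \<le> (2 + x\<^sup>2 / 2) * u\<^sup>2" .
  moreover have "0 < u\<^sup>2" "0 < 1 + u\<^sup>2" using False by (auto intro: add_pos_nonneg)
  ultimately have "1 - cos (x * u) \<le> (2 + x\<^sup>2 / 2) * u\<^sup>2 / (1 + u\<^sup>2)"
    by (simp only: pos_le_divide_eq)
  also have "\<dots> = (2 + x\<^sup>2 / 2) / (1 + u\<^sup>2) * u\<^sup>2" by simp
  finally show ?thesis
    unfolding fejer_def using \<open>0 < u\<^sup>2\<close> by (simp only: pos_divide_le_eq divide_inverse[symmetric])
qed (simp add: fejer_def)

lemma integrable_fejer: "integrable lborel (fejer x)"
proof (rule Bochner_Integration.integrable_bound)
  show "integrable lborel (\<lambda>u::real. (2 + x\<^sup>2 / 2) * inverse (1 + u\<^sup>2))"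
    using integrable_inverse_1_plus_square by (simp add: set_integrable_def)
  show "fejer x \<in> borel_measurable lborel"
    unfolding fejer_def by measurable
  show "AE u in lborel. norm (fejer x u) \<le> norm ((2 + x\<^sup>2 / 2) * inverse (1 + u\<^sup>2))"
    using fejer_le[of x] fejer_nonneg[of x] by (intro AE_I2) (auto intro: order_trans[OF _ abs_ge_self])
qed

definition fejer_mass :: real where
  "fejer_mass = (\<integral>u. fejer 1 u \<partial>lborel)"

text \<open>
  By the substitution \<open>v = x u\<close>. Normalising by \<open>fejer_mass\<close>, whose value is \<open>\<pi>\<close>, replaces the
  evaluation of the integral; its positivity is enough for that.
\<close>

lemma integral_fejer: "(\<integral>u. fejer x u \<partial>lborel) = \<bar>x\<bar> * fejer_mass"
proof (cases "x = 0")
  case False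
  have "fejer_mass = \<bar>x\<bar> * (\<integral>u. fejer 1 (0 + x * u) \<partial>lborel)"
    unfolding fejer_mass_def by (subst lborel_integral_real_affine[OF False, of _ 0]) simp
  also have "(\<lambda>u. fejer 1 (0 + x * u)) = (\<lambda>u. fejer x u / x\<^sup>2)"
    by (simp add: fejer_def fun_eq_iff power_mult_distrib)
  finally have "fejer_mass = \<bar>x\<bar> * ((\<integral>u. fejer x u \<partial>lborel) / x\<^sup>2)" by simp
  then have "\<bar>x\<bar> * fejer_mass = \<bar>x\<bar> * \<bar>x\<bar> * ((\<integral>u. fejer x u \<partial>lborel) / x\<^sup>2)"
    by (simp only: mult.assoc)
  also have "\<bar>x\<bar> * \<bar>x\<bar> = x\<^sup>2" by (simp add: power2_eq_square)
  finally show ?thesis using False by simp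
qed (simp add: fejer_def)

lemma fejer_mass_pos: "0 < fejer_mass"
proof -
  define c where "c = (1 - cos 1) / (4::real)"
  have c: "c > 0" unfolding c_def using cos_monotone_0_pi[of 0 1] pi_gt3 by simp
  have int: "integrable lborel (\<lambda>u::real. c * indicator {1..2} u)" by simp
  have "c * indicator {1..2} u \<le> fejer 1 u" for u :: real
  proof (cases "u \<in> {1..2}")
    case True
    have "cos u \<le> cos 1" using True pi_gt3 by (intro cos_monotone_0_pi_le) auto
    moreover have "u\<^sup>2 \<le> 4" using True power_mono[of u 2 2] by auto
    moreover have "cos 1 \<le> (1::real)" by simp
    ultimately have "(1 - cos 1) / 4 \<le> (1 - cos u) / u\<^sup>2"
      using True by (intro frac_le) auto
    then show ?thesis using True by (simp add: fejer_def c_def)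
  qed (simp add: fejer_nonneg)
  then have "(\<integral>u. c * indicator {1..2::real} u \<partial>lborel) \<le> fejer_mass"
    unfolding fejer_mass_def by (intro integral_mono int integrable_fejer)
  moreover have "(\<integral>u. c * indicator {1..2::real} u \<partial>lborel) = c" by simp
  ultimately show ?thesis using c by simp
qed

text \<open>
  The Fourier transform of the Fejer kernel is the hat function: by the product formula for cosines the
  integrand is a second difference in \<open>x\<close> of \<open>fejer x\<close>, the integral of \<open>fejer x\<close> is proportional to
  \<open>\<bar>x\<bar>\<close>, and the second difference of the absolute value is a hat.
\<close>

lemma has_integral_fejer_cos:
  "integrable lborel (\<lambda>u. fejer 1 u * cos (x * u))"
  "(\<integral>u. fejer 1 u * cos (x * u) \<partial>lborel) = fejer_mass * hat x"
proof -
  have eq: "fejer 1 u * cos (x * u) = (fejer (x + 1) u + fejer (x - 1) u) / 2 - fejer x u" for u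
  proof -
    have "(1 - cos u) * cos (x * u)
        = ((1 - cos ((x + 1) * u)) + (1 - cos ((x - 1) * u))) / 2 - (1 - cos (x * u))"
      by (simp add: algebra_simps cos_add cos_diff field_simps)
    then have "(1 - cos u) * cos (x * u) / u\<^sup>2
        = (((1 - cos ((x + 1) * u)) + (1 - cos ((x - 1) * u))) / 2 - (1 - cos (x * u))) / u\<^sup>2"
      by (simp only:)
    then show ?thesis unfolding fejer_def
      by (simp only: mult_1 diff_divide_distrib[symmetric] add_divide_distrib[symmetric] times_divide_eq_left
          divide_divide_eq_left mult.commute[of 2 "u\<^sup>2"])
         (simp only: diff_divide_distrib divide_divide_eq_left mult.commute[of 2 "u\<^sup>2"])
  qed
  show "integrable lborel (\<lambda>u. fejer 1 u * cos (x * u))"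
    unfolding eq by (simp add: integrable_fejer)
  show "(\<integral>u. fejer 1 u * cos (x * u) \<partial>lborel) = fejer_mass * hat x"
  proof -
    have hat: "hat x = (\<bar>x + 1\<bar> + \<bar>x - 1\<bar>) / 2 - \<bar>x\<bar>" using hat_second_difference[of x] by (simp add: field_simps)
    show ?thesis unfolding eq hat by (simp add: integrable_fejer integral_fejer field_simps)
  qed
qed

lemma has_integral_fejer_sin:
  "integrable lborel (\<lambda>u. fejer 1 u * sin (x * u))"
  "(\<integral>u. fejer 1 u * sin (x * u) \<partial>lborel) = 0"
proof -
  show "integrable lborel (\<lambda>u. fejer 1 u * sin (x * u))"
  proof (rule Bochner_Integration.integrable_bound[OF integrable_fejer[of 1]])
    show "(\<lambda>u. fejer 1 u * sin (x * u)) \<in> borel_measurable lborel"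
      unfolding fejer_def by measurable
    show "AE u in lborel. norm (fejer 1 u * sin (x * u)) \<le> norm (fejer 1 u)"
      by (intro AE_I2) (auto simp: abs_mult intro!: mult_left_le)
  qed
  have "(\<integral>u. fejer 1 u * sin (x * u) \<partial>lborel)
      = \<bar>-1\<bar> *\<^sub>R (\<integral>u. fejer 1 (0 + -1 * u) * sin (x * (0 + -1 * u)) \<partial>lborel)"
    by (rule lborel_integral_real_affine) simp
  also have "\<dots> = - (\<integral>u. fejer 1 u * sin (x * u) \<partial>lborel)"
    by (simp add: fejer_def)
  finally show "(\<integral>u. fejer 1 u * sin (x * u) \<partial>lborel) = 0" by simp
qed

lemma has_integral_fejer_exp:
  "has_bochner_integral lborel (\<lambda>u. complex_of_real (fejer 1 u) * exp (\<i> * of_real (x * u)))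
     (complex_of_real (fejer_mass * hat x))"
proof -
  have eq: "complex_of_real (fejer 1 u) * exp (\<i> * of_real (x * u))
      = of_real (fejer 1 u * cos (x * u)) + \<i> * of_real (fejer 1 u * sin (x * u))" for u
    using cis_conv_exp[of "x * u"] by (simp add: complex_eq_iff flip: cis_conv_exp)
  have "has_bochner_integral lborel (\<lambda>u. complex_of_real (fejer 1 u * cos (x * u)) + \<i> * of_real (fejer 1 u * sin (x * u)))
     (complex_of_real (fejer_mass * hat x) + \<i> * of_real 0)"
    using has_integral_fejer_cos[of x] has_integral_fejer_sin[of x]
    by (intro has_bochner_integral_add has_bochner_integral_mult_right has_bochner_integral_of_real)
      (auto simp: has_bochner_integral_iff)
  then show ?thesis unfolding eq by simp
qed

text \<open>
  Weighting the coefficients with a hat function averages the vertical translates of the polynomial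
  (modulated by the centre \<open>j\<close>) against the Fejer kernel, which is nonnegative. The supremum on the
  line therefore does not grow, whatever the exponents are.
\<close>

lemma hat_multiplier_contraction:
  assumes "finite T" and B: "\<And>s. Re s = \<sigma> \<Longrightarrow> cmod (\<Sum>t\<in>T. c t * exp (- s * complex_of_real t)) \<le> B"
    and s: "Re s = \<sigma>"
  shows "cmod (\<Sum>t\<in>T. c t * of_real (hat (t - j)) * exp (- s * complex_of_real t)) \<le> B"
proof -
  define P where "P s = (\<Sum>t\<in>T. c t * exp (- s * complex_of_real t))" for s
  define L where "L = (\<Sum>t\<in>T. c t * of_real (hat (t - j)) * exp (- s * complex_of_real t))"
  have "has_bochner_integral lborel
      (\<lambda>u. \<Sum>t\<in>T. (c t * exp (- s * complex_of_real t)) *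
          (complex_of_real (fejer 1 u) * exp (\<i> * of_real ((t - j) * u))))
      (\<Sum>t\<in>T. (c t * exp (- s * complex_of_real t)) * complex_of_real (fejer_mass * hat (t - j)))"
    by (intro has_bochner_integral_sum has_bochner_integral_mult_right has_integral_fejer_exp)
  also have "(\<lambda>u. \<Sum>t\<in>T. (c t * exp (- s * complex_of_real t)) *
          (complex_of_real (fejer 1 u) * exp (\<i> * of_real ((t - j) * u))))
      = (\<lambda>u. complex_of_real (fejer 1 u) * exp (- \<i> * of_real (j * u)) * P (s - \<i> * of_real u))"
    unfolding P_def sum_distrib_left
    by (intro ext sum.cong refl) (simp add: algebra_simps flip: exp_add)
  also have "(\<Sum>t\<in>T. (c t * exp (- s * complex_of_real t)) * complex_of_real (fejer_mass * hat (t - j)))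
      = of_real fejer_mass * L"
    unfolding L_def sum_distrib_left by (intro sum.cong refl) simp
  finally have int: "has_bochner_integral lborel
      (\<lambda>u. complex_of_real (fejer 1 u) * exp (- \<i> * of_real (j * u)) * P (s - \<i> * of_real u))
      (of_real fejer_mass * L)" .
  have "cmod (of_real fejer_mass * L) \<le> (\<integral>u. fejer 1 u * B \<partial>lborel)"
    unfolding has_bochner_integral_integral_eq[OF int, symmetric]
  proof (rule Bochner_Integration.integral_norm_bound_integral)
    fix u
    have "cmod (P (s - \<i> * of_real u)) \<le> B" unfolding P_def by (rule B) (simp add: s)
    moreover have "cmod (exp (- \<i> * of_real (j * u))) = 1" by simp
    ultimately show "cmod (complex_of_real (fejer 1 u) * exp (- \<i> * of_real (j * u)) * P (s - \<i> * of_real u))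
        \<le> fejer 1 u * B"
      using fejer_nonneg[of 1 u] by (simp add: norm_mult mult_left_mono)
  qed (use int integrable_fejer[of 1] in \<open>auto simp: has_bochner_integral_iff\<close>)
  also have "\<dots> = fejer_mass * B" by (simp add: fejer_mass_def)
  finally show ?thesis using fejer_mass_pos by (simp add: norm_mult L_def)
qed

section \<open>Splitting an exponential polynomial by the sign of its exponents\<close>

text \<open>
  Dividing a bounded function by \<open>1 + e s\<close>, which has modulus at least \<open>1\<close> on the half-plane, makes it
  small on large half-circles, so the maximum principle applies to half-discs; then \<open>e\<close> tends to \<open>0\<close>.
\<close>

lemma phragmen_lindelof_rhp:
  assumes hol: "F holomorphic_on {s. Re s > 0}" and cont: "continuous_on {s. Re s \<ge> 0} F"
    and M: "\<And>s. Re s = 0 \<Longrightarrow> cmod (F s) \<le> M"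
    and bdd: "\<And>s. Re s \<ge> 0 \<Longrightarrow> cmod (F s) \<le> M0"
    and s: "Re s \<ge> 0"
  shows "cmod (F s) \<le> M"
proof (cases "Re s = 0")
  case False
  then have s0: "Re s > 0" using s by simp
  have M_nonneg: "M \<ge> 0" using order_trans[OF norm_ge_zero M[of 0]] by simp
  have bound: "cmod (F s) \<le> (M + e) * (1 + e * cmod s)" if e: "e > 0" for e
  proof -
    define g where "g z = F z / (1 + of_real e * z)" for z
    have den: "cmod (1 + of_real e * z) \<ge> 1" "1 + of_real e * z \<noteq> 0"
      if "Re z \<ge> 0" for z
    proof -
      have "1 \<le> Re (1 + of_real e * z)" using that e by simp
      also have "\<dots> \<le> cmod (1 + of_real e * z)" by (rule complex_Re_le_cmod)
      finally show *: "cmod (1 + of_real e * z) \<ge> 1" .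
      then show "1 + of_real e * z \<noteq> 0" by auto
    qed
    have den2: "e * cmod z \<le> cmod (1 + of_real e * z)" if "Re z \<ge> 0" for z
    proof (rule power2_le_imp_le)
      show "(e * cmod z)\<^sup>2 \<le> (cmod (1 + of_real e * z))\<^sup>2"
        using that e unfolding power_mult_distrib cmod_power2
        by (simp add: power2_eq_square algebra_simps)
    qed simp
    define R where "R = max (cmod s + 1) (M0 / (e * (M + e)))"
    define S where "S = {z. Re z > 0} \<inter> ball 0 R"
    have S: "open S" "S \<subseteq> {z. Re z \<ge> 0}"
      unfolding S_def by (auto intro!: open_Int open_halfspace_Re_gt)
    have clS: "closure S \<subseteq> {z. Re z \<ge> 0} \<inter> cball 0 R"
      unfolding S_def by (intro closure_minimal closed_Int closed_halfspace_Re_ge) auto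
    have "cmod (g s) \<le> M + e"
    proof (rule maximum_modulus_frontier[of g S])
      show "g holomorphic_on interior S"
        unfolding g_def interior_open[OF S(1)] using den(2) S
        by (intro holomorphic_intros holomorphic_on_subset[OF hol]) (auto simp: S_def)
      show "continuous_on (closure S) g"
        unfolding g_def using clS den(2)
        by (intro continuous_intros continuous_on_subset[OF cont]) auto
      show "bounded S" unfolding S_def by auto
      show "s \<in> S" using s0 by (simp add: S_def R_def)
      fix z assume "z \<in> frontier S"
      then have "z \<in> closure S" "z \<notin> S" using S(1) by (auto simp: frontier_def interior_open)
      then have z: "Re z \<ge> 0" "cmod z \<le> R" "Re z = 0 \<or> cmod z \<ge> R"
        using clS by (auto simp: S_def)
      show "cmod (g z) \<le> M + e"
      proof (cases "Re z = 0")
        case True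
        have "cmod (g z) \<le> (M + e) / 1" unfolding g_def norm_divide
          using M[OF True] den(1)[OF z(1)] M_nonneg e by (intro frac_le) auto
        then show ?thesis by simp
      next
        case False
        then have "cmod z \<ge> M0 / (e * (M + e))" using z by (simp add: R_def)
        moreover have "e * (M + e) > 0" using e M_nonneg by simp
        ultimately have "M0 \<le> cmod z * (e * (M + e))" by (simp only: pos_divide_le_eq)
        then have "M0 \<le> (M + e) * (e * cmod z)" by (simp only: mult_ac)
        also have "\<dots> \<le> (M + e) * cmod (1 + of_real e * z)"
          using den2[OF z(1)] e M_nonneg by (intro mult_left_mono) auto
        finally have "cmod (F z) \<le> (M + e) * cmod (1 + of_real e * z)" using bdd[OF z(1)] by linarith
        moreover have "cmod (1 + of_real e * z) > 0" using den(2)[OF z(1)] by simp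
        ultimately show ?thesis by (simp add: g_def norm_divide pos_divide_le_eq)
      qed
    qed
    then have "cmod (F s) \<le> (M + e) * cmod (1 + of_real e * s)"
      using den(2)[OF s] by (simp add: g_def norm_divide divide_le_eq)
    also have "cmod (1 + of_real e * s) \<le> 1 + e * cmod s"
      using norm_triangle_ineq[of 1 "of_real e * s"] e by (simp add: norm_mult)
    finally show ?thesis using M_nonneg e by (simp add: mult_left_mono)
  qed
  have "((\<lambda>e. (M + e) * (1 + e * cmod s)) \<longlongrightarrow> (M + 0) * (1 + 0 * cmod s)) (at_right 0)"
    by (intro tendsto_intros)
  moreover have "\<forall>\<^sub>F e in at_right 0. cmod (F s) \<le> (M + e) * (1 + e * cmod s)"
    using bound by (auto simp: eventually_at_right_field intro: exI[of _ 1])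
  ultimately have "cmod (F s) \<le> (M + 0) * (1 + 0 * cmod s)"
    by (rule tendsto_lowerbound) simp
  then show ?thesis by simp
qed (use M in simp)

text \<open>
  The exponents of the block are larger than \<open>j - 1\<close>. After division by \<open>exp (- (j - 1) s)\<close> only
  nonnegative exponents remain, so the quotient is bounded to the right of the line and obeys the
  maximum principle there.
\<close>

lemma hat_block_decay_right:
  assumes fin: "finite T"
    and B: "\<And>s. Re s = p \<Longrightarrow> cmod (\<Sum>t\<in>T. c t * exp (- s * complex_of_real t)) \<le> B"
    and s: "p \<le> Re s"
  shows "cmod (\<Sum>t\<in>T. c t * of_real (hat (t - j)) * exp (- s * complex_of_real t))
           \<le> exp (- (j - 1) * (Re s - p)) * B"
proof -
  define F where "F z = (\<Sum>t\<in>T. c t * of_real (hat (t - j)) * exp (- (z + of_real p) * complex_of_real t))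
      * exp ((of_real (j - 1)) * z)" for z
  have expR: "cmod (exp (of_real (j - 1) * z)) = exp ((j - 1) * Re z)" for z by simp
  have "cmod (F (s - of_real p)) \<le> B"
  proof (rule phragmen_lindelof_rhp[of F])
    show "F holomorphic_on {s. 0 < Re s}" unfolding F_def by (intro holomorphic_intros)
    show "continuous_on {s. 0 \<le> Re s} F" unfolding F_def by (intro continuous_intros)
    show "cmod (F z) \<le> B" if "Re z = 0" for z
      using hat_multiplier_contraction[OF fin B, of p "z + of_real p" j] that
      by (simp add: F_def norm_mult)
    show "cmod (F z) \<le> (\<Sum>t\<in>T. cmod (c t) * exp (- p * t))" if z: "0 \<le> Re z" for z
      unfolding F_def sum_distrib_right
    proof (rule sum_norm_le)
      fix t assume "t \<in> T"
      show "cmod (c t * of_real (hat (t - j)) * exp (- (z + of_real p) * complex_of_real t)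
          * exp (of_real (j - 1) * z)) \<le> cmod (c t) * exp (- p * t)"
      proof (cases "j - 1 \<le> t")
        case True
        have "cmod (c t * of_real (hat (t - j)) * exp (- (z + of_real p) * complex_of_real t)
          * exp (of_real (j - 1) * z))
          = cmod (c t) * (hat (t - j) * exp (- p * t - Re z * (t - (j - 1))))"
          unfolding norm_mult expR norm_exp_mult_real
          by (simp add: hat_nonneg algebra_simps exp_add exp_diff exp_minus field_simps)
        also have "\<dots> \<le> cmod (c t) * (1 * exp (- p * t))"
          using True z by (intro mult_left_mono mult_mono) (auto simp: hat_le_1 hat_nonneg)
        finally show ?thesis by simp
      next
        case False
        then have "hat (t - j) = 0" by (simp add: hat_def)
        then show ?thesis by simp
      qed
    qed
    show "0 \<le> Re (s - of_real p)" using s by simp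
  qed
  then have "cmod (\<Sum>t\<in>T. c t * of_real (hat (t - j)) * exp (- s * complex_of_real t))
      * exp ((j - 1) * (Re s - p)) \<le> B"
    unfolding F_def norm_mult expR by simp
  then have "cmod (\<Sum>t\<in>T. c t * of_real (hat (t - j)) * exp (- s * complex_of_real t))
      \<le> B / exp ((j - 1) * (Re s - p))" by (simp only: pos_le_divide_eq exp_gt_zero)
  also have "\<dots> = exp (- (j - 1) * (Re s - p)) * B"
    by (simp only: mult_minus_left exp_minus divide_inverse mult.commute[of B])
  finally show ?thesis .
qed

text \<open>
  The mirror image under \<open>s \<mapsto> - s\<close>, \<open>t \<mapsto> - t\<close>, \<open>j \<mapsto> - j\<close>.
\<close>

lemma hat_block_decay_left:
  assumes fin: "finite T"
    and B: "\<And>s. Re s = q \<Longrightarrow> cmod (\<Sum>t\<in>T. c t * exp (- s * complex_of_real t)) \<le> B"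
    and s: "Re s \<le> q"
  shows "cmod (\<Sum>t\<in>T. c t * of_real (hat (t - j)) * exp (- s * complex_of_real t))
           \<le> exp ((j + 1) * (q - Re s)) * B"
proof -
  have reflect: "(\<Sum>t\<in>uminus ` T. f t) = (\<Sum>t\<in>T. f (- t))" for f :: "real \<Rightarrow> complex"
    by (subst sum.reindex) (auto simp: inj_on_def)
  have sym: "hat (- t + j) = hat (t - j)" for t by (simp add: hat_def abs_minus_commute)
  have "cmod (\<Sum>t\<in>uminus ` T. c (- t) * of_real (hat (t - (- j))) * exp (- (- s) * complex_of_real t))
      \<le> exp (- (- j - 1) * (Re (- s) - (- q))) * B"
  proof (rule hat_block_decay_right)
    show "cmod (\<Sum>t\<in>uminus ` T. c (- t) * exp (- z * complex_of_real t)) \<le> B" if "Re z = - q" for z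
      using B[of "- z"] that unfolding reflect by simp
  qed (use fin s in auto)
  then have "cmod (\<Sum>t\<in>T. c t * of_real (hat (- t + j)) * exp (- s * complex_of_real t))
      \<le> exp ((j + 1) * (q - Re s)) * B"
    unfolding reflect by (simp add: algebra_simps)
  then show ?thesis unfolding sym .
qed

lemma sum_exp_geometric_le:
  assumes "x > (0::real)"
  shows "(\<Sum>k<N. exp (- real k * x)) \<le> 1 / (1 - exp (- x))"
proof -
  have "exp (- x) < 1" using assms by simp
  have "(\<Sum>k<N. exp (- real k * x)) = (\<Sum>k<N. exp (- x) ^ k)"
    by (simp add: exp_of_nat_mult[symmetric])
  also have "\<dots> = (1 - exp (- x) ^ N) / (1 - exp (- x))"
    using \<open>exp (- x) < 1\<close> by (simp add: sum_gp_strict)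
  also have "\<dots> \<le> 1 / (1 - exp (- x))"
    using \<open>exp (- x) < 1\<close> by (intro divide_right_mono) auto
  finally show ?thesis .
qed

text \<open>
  Hat functions centred at the integers form a partition of unity. Those centred at \<open>1, 2, \<dots>\<close>
  add up to the ramp, which vanishes for negative exponents; this causal part is estimated from the left edge
  \<open>Re s = p\<close>, the rest from the right edge \<open>Re s = q\<close>. Both estimates are geometric series because
  \<open>m\<close> keeps a positive distance from either edge. A sharp cut at exponent \<open>0\<close> would not admit a
  bound that is independent of the exponents.
\<close>

lemma exp_poly_splitting:
  assumes "p < m" "m < q"
  obtains C where "C > 0"
    "\<And>Q B. Q \<in> exp_polys G \<Longrightarrow> (\<And>s. s \<in> vstrip p q \<Longrightarrow> cmod (Q s) \<le> B) \<Longrightarrow>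
       \<exists>Q1 Q2. Q1 \<in> exp_polys G \<and> Q2 \<in> exp_polys (G \<inter> {0..}) \<and> (\<forall>s. Q s = Q1 s - Q2 s) \<and>
         (\<forall>s\<in>vstrip a m. cmod (Q1 s) \<le> C * B) \<and> (\<forall>s\<in>rhp m. cmod (Q2 s) \<le> C * B)"
proof -
  define C1 where "C1 = 1 / (1 - exp (- (m - p)))"
  define C2 where "C2 = exp (q - a) * (1 / (1 - exp (- (q - m))))"
  have C: "C1 > 0" "C2 > 0" using assms unfolding C1_def C2_def by (auto intro!: mult_pos_pos divide_pos_pos)
  show thesis
  proof (rule that[of "C1 + C2"])
    fix Q B assume Q: "Q \<in> exp_polys G" and B: "\<And>s. s \<in> vstrip p q \<Longrightarrow> cmod (Q s) \<le> B"
    obtain T c where T: "finite T" "T \<subseteq> G" "\<And>s. Q s = (\<Sum>t\<in>T. c t * exp (- s * complex_of_real t))"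
      using Q by (rule exp_polysE) blast
    have B0: "B \<ge> 0" using order_trans[OF norm_ge_zero B[of "of_real p"]] assms by (simp add: vstrip_def)
    have "finite (abs ` T)" using T(1) by simp
    then obtain b where b: "\<And>t. t \<in> T \<Longrightarrow> \<bar>t\<bar> \<le> b" using bdd_above_finite[of "abs ` T"]
      by (auto simp: bdd_above_def)
    obtain N :: nat where N: "b + 1 \<le> real N" using real_arch_simple by blast
    \<comment> \<open>Differences of shifted ramps telescope. The number \<open>N\<close> of blocks exceeds all exponents by at least
      \<open>1\<close>, so that the far end of each telescope is constant on \<open>T\<close>.\<close>
    have block: "(\<Sum>k<n. hat (t - (real k + 1))) = ramp t - ramp (t - real n)" for t n
      by (induction n) (auto simp: hat_eq_ramp_diff algebra_simps)
    have block': "(\<Sum>k<n. hat (t - (- real k))) = ramp (t + real n) - ramp t" for t n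
      by (induction n) (auto simp: hat_eq_ramp_diff algebra_simps)
    define Q2 where "Q2 s = (\<Sum>t\<in>T. - (c t * of_real (ramp t)) * exp (- s * complex_of_real t))" for s
    define Q1 where "Q1 s = (\<Sum>t\<in>T. (c t * of_real (1 - ramp t)) * exp (- s * complex_of_real t))" for s
    have "Q1 \<in> exp_polys G" unfolding Q1_def by (rule exp_polysI[OF T(1,2)]) (rule refl)
    moreover have "Q2 \<in> exp_polys (G \<inter> {0..})"
    proof (rule exp_polysI[of "T \<inter> {0..}"])
      show "Q2 s = (\<Sum>t\<in>T \<inter> {0..}. - (c t * of_real (ramp t)) * exp (- s * complex_of_real t))" for s
        unfolding Q2_def using T(1) by (intro sum.mono_neutral_right) (auto simp: ramp_def)
    qed (use T in auto)
    moreover have "Q s = Q1 s - Q2 s" for s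
      unfolding T(3) Q1_def Q2_def sum_subtractf[symmetric]
      by (intro sum.cong refl) (simp add: algebra_simps)
    moreover have "cmod (Q2 s) \<le> (C1 + C2) * B" if s: "s \<in> rhp m" for s
    proof -
      have "Q2 s = - (\<Sum>k<N. \<Sum>t\<in>T. c t * of_real (hat (t - (real k + 1))) * exp (- s * complex_of_real t))"
      proof -
        have "of_real (ramp t) = (\<Sum>k<N. complex_of_real (hat (t - (real k + 1))))" if "t \<in> T" for t
        proof -
          have "ramp (t - real N) = 0" using b[OF that] N by (auto simp: ramp_def)
          then show ?thesis using block[of t N] by (simp flip: of_real_sum)
        qed
        then have "Q2 s = (\<Sum>t\<in>T. - (\<Sum>k<N. c t * of_real (hat (t - (real k + 1))) * exp (- s * complex_of_real t)))"
          unfolding Q2_def by (intro sum.cong refl) (simp add: sum_distrib_left sum_distrib_right)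
        then show ?thesis by (simp add: sum_negf sum.swap[of _ T])
      qed
      then have "cmod (Q2 s) \<le> (\<Sum>k<N. exp (- real k * (m - p)) * B)"
      proof (simp only: norm_minus_cancel, intro sum_norm_le)
        fix k
        have "cmod (\<Sum>t\<in>T. c t * of_real (hat (t - (real k + 1))) * exp (- s * complex_of_real t))
            \<le> exp (- ((real k + 1) - 1) * (Re s - p)) * B"
          using B assms s unfolding T(3)
          by (intro hat_block_decay_right[OF T(1)]) (auto simp: vstrip_def rhp_def)
        also have "\<dots> \<le> exp (- real k * (m - p)) * B"
          using s B0 by (intro mult_right_mono) (auto simp: rhp_def intro!: mult_left_mono)
        finally show "cmod (\<Sum>t\<in>T. c t * of_real (hat (t - (real k + 1))) * exp (- s * complex_of_real t))
            \<le> exp (- real k * (m - p)) * B" .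
      qed
      also have "\<dots> \<le> C1 * B"
        unfolding sum_distrib_right[symmetric] C1_def
        using assms B0 by (intro mult_right_mono sum_exp_geometric_le) auto
      also have "\<dots> \<le> (C1 + C2) * B" using C B0 by (intro mult_right_mono) auto
      finally show ?thesis .
    qed
    moreover have "cmod (Q1 s) \<le> (C1 + C2) * B" if s: "s \<in> vstrip a m" for s
    proof -
      have "Q1 s = (\<Sum>k<N. \<Sum>t\<in>T. c t * of_real (hat (t - (- real k))) * exp (- s * complex_of_real t))"
      proof -
        have "of_real (1 - ramp t) = (\<Sum>k<N. complex_of_real (hat (t - (- real k))))" if "t \<in> T" for t
        proof -
          have "ramp (t + real N) = 1" using b[OF that] N by (auto simp: ramp_def)
          then show ?thesis using block'[of t N] by (simp only: of_real_sum[symmetric])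
        qed
        then have "Q1 s = (\<Sum>t\<in>T. \<Sum>k<N. c t * of_real (hat (t - (- real k))) * exp (- s * complex_of_real t))"
          unfolding Q1_def by (intro sum.cong refl) (simp only: sum_distrib_left sum_distrib_right)
        then show ?thesis by (simp only: sum.swap[of _ T])
      qed
      then have "cmod (Q1 s) \<le> (\<Sum>k<N. exp (- real k * (q - m)) * (exp (q - a) * B))"
      proof (simp only:, intro sum_norm_le)
        fix k
        have "cmod (\<Sum>t\<in>T. c t * of_real (hat (t - (- real k))) * exp (- s * complex_of_real t))
            \<le> exp ((- real k + 1) * (q - Re s)) * B"
          using B assms s unfolding T(3)
          by (intro hat_block_decay_left[OF T(1)]) (auto simp: vstrip_def)
        also have "(- real k + 1) * (q - Re s) \<le> - real k * (q - m) + (q - a)"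
        proof -
          have "real k * (q - m) \<le> real k * (q - Re s)"
            using s by (intro mult_left_mono) (auto simp: vstrip_def)
          then show ?thesis using s by (simp add: vstrip_def algebra_simps)
        qed
        then have "exp ((- real k + 1) * (q - Re s)) * B \<le> exp (- real k * (q - m) + (q - a)) * B"
          using B0 by (intro mult_right_mono) auto
        finally show "cmod (\<Sum>t\<in>T. c t * of_real (hat (t - (- real k))) * exp (- s * complex_of_real t))
            \<le> exp (- real k * (q - m)) * (exp (q - a) * B)"
          by (simp only: exp_add mult.assoc)
      qed
      also have "\<dots> \<le> 1 / (1 - exp (- (q - m))) * (exp (q - a) * B)"
        unfolding sum_distrib_right[symmetric]
        using assms B0 by (intro mult_right_mono sum_exp_geometric_le) auto
      also have "\<dots> = C2 * B" by (simp add: C2_def)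
      also have "\<dots> \<le> (C1 + C2) * B" using C B0 by (intro mult_right_mono) auto
      finally show ?thesis .
    qed
    ultimately show "\<exists>Q1 Q2. Q1 \<in> exp_polys G \<and> Q2 \<in> exp_polys (G \<inter> {0..}) \<and> (\<forall>s. Q s = Q1 s - Q2 s) \<and>
         (\<forall>s\<in>vstrip a m. cmod (Q1 s) \<le> (C1 + C2) * B) \<and> (\<forall>s\<in>rhp m. cmod (Q2 s) \<le> (C1 + C2) * B)"
      by blast
  qed (use C in simp)
qed


section \<open>The corona theorem for exponential polynomials\<close>

text \<open>
  Solvability up to an error of \<open>1 / 2\<close> with solutions from \<open>E\<close> itself rather than from its closure;
  an exact solution in the closure results from dividing by the left-hand side.
\<close>

definition bezout_on ::
  "complex set \<Rightarrow> (complex \<Rightarrow> complex) set \<Rightarrow> 'i set \<Rightarrow> ('i \<Rightarrow> complex \<Rightarrow> complex) \<Rightarrow> bool" where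
  "bezout_on S E I f \<longleftrightarrow> (\<exists>X. (\<forall>i\<in>I. X i \<in> E) \<and>
     (\<forall>s\<in>S. cmod ((\<Sum>i\<in>I. f i s * X i s) - 1) \<le> 1 / 2))"

lemma bezout_onI:
  assumes "\<And>i. i \<in> I \<Longrightarrow> X i \<in> E" "\<And>s. s \<in> S \<Longrightarrow> cmod ((\<Sum>i\<in>I. f i s * X i s) - 1) \<le> 1 / 2"
  shows "bezout_on S E I f"
  unfolding bezout_on_def using assms by (intro exI[of _ X]) simp

lemma bezout_onE:
  assumes "bezout_on S E I f"
  obtains X where "\<And>i. i \<in> I \<Longrightarrow> X i \<in> E" "\<And>s. s \<in> S \<Longrightarrow> cmod ((\<Sum>i\<in>I. f i s * X i s) - 1) \<le> 1 / 2"
  using assms unfolding bezout_on_def by auto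

lemma norm_sum_products_le:
  fixes f g :: "'i \<Rightarrow> complex"
  assumes "\<And>i. i \<in> I \<Longrightarrow> cmod (f i) \<le> K" "\<And>i. i \<in> I \<Longrightarrow> cmod (g i) \<le> e"
  shows "cmod (\<Sum>i\<in>I. f i * g i) \<le> real (card I) * K * e"
proof -
  have "cmod (\<Sum>i\<in>I. f i * g i) \<le> (\<Sum>i\<in>I. K * e)"
  proof (rule sum_norm_le)
    fix i assume "i \<in> I"
    then show "cmod (f i * g i) \<le> K * e"
      unfolding norm_mult using assms by (intro mult_mono) (auto intro: order_trans[OF norm_ge_zero])
  qed
  then show ?thesis by simp
qed

lemma bezout_perturb:
  fixes f x X :: "'i \<Rightarrow> complex"
  assumes "(\<Sum>i\<in>I. f i * x i) = 1"
    and "\<And>i. i \<in> I \<Longrightarrow> cmod (f i) \<le> K" "\<And>i. i \<in> I \<Longrightarrow> cmod (X i - x i) \<le> e"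
  shows "cmod ((\<Sum>i\<in>I. f i * X i) - 1) \<le> real (card I) * K * e"
proof -
  have "(\<Sum>i\<in>I. f i * X i) - 1 = (\<Sum>i\<in>I. f i * (X i - x i))"
    unfolding assms(1)[symmetric] by (simp add: sum_subtractf right_diff_distrib)
  then show ?thesis using norm_sum_products_le[of I f K "\<lambda>i. X i - x i" e] assms by simp
qed

text \<open>
  Horizontal displacement changes each term by an amount that does not depend on the imaginary part,
  so a finite sum is continuous in this direction uniformly along the whole line.
\<close>

lemma exp_polys_horizontal_continuity:
  assumes Q: "Q \<in> exp_polys H" and "\<epsilon> > 0"
  obtains \<eta> where "\<eta> > 0"
    "\<And>s. \<bar>Re s - \<alpha>\<bar> \<le> \<eta> \<Longrightarrow> cmod (Q s - Q (Complex \<alpha> (Im s))) \<le> \<epsilon>"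
proof -
  obtain T c where T: "finite T" "\<And>s. Q s = (\<Sum>t\<in>T. c t * exp (- s * complex_of_real t))"
    using Q by (rule exp_polysE) blast
  define h where "h x = (\<Sum>t\<in>T. cmod (c t) * \<bar>exp (- x * t) - exp (- \<alpha> * t)\<bar>)" for x
  have "(h \<longlongrightarrow> h \<alpha>) (at \<alpha>)"
    unfolding h_def by (intro tendsto_intros)
  then have "isCont h \<alpha>" by (simp add: isCont_def)
  moreover have "h \<alpha> = 0" by (simp add: h_def)
  ultimately obtain d where d: "d > 0" "\<And>x. \<bar>x - \<alpha>\<bar> < d \<Longrightarrow> \<bar>h x\<bar> < \<epsilon>"
    using \<open>\<epsilon> > 0\<close> unfolding continuous_at_eps_delta dist_real_def by force
  show thesis
  proof (rule that[of "d / 2"])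
    fix s assume s: "\<bar>Re s - \<alpha>\<bar> \<le> d / 2"
    have "Q s - Q (Complex \<alpha> (Im s)) = (\<Sum>t\<in>T. c t * (exp (- s * complex_of_real t) - exp (- Complex \<alpha> (Im s) * complex_of_real t)))"
      unfolding T(2) by (simp add: sum_subtractf right_diff_distrib)
    also have "cmod \<dots> \<le> h (Re s)" unfolding h_def
    proof (rule sum_norm_le)
      fix t
      have *: "exp (- Complex x (Im s) * complex_of_real t) = of_real (exp (- x * t)) * cis (- Im s * t)" for x
        by (simp add: exp_eq_polar)
      have "exp (- s * complex_of_real t) - exp (- Complex \<alpha> (Im s) * complex_of_real t)
          = of_real (exp (- Re s * t) - exp (- \<alpha> * t)) * cis (- Im s * t)"
        using *[of "Re s"] *[of \<alpha>] by (simp add: left_diff_distrib)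
      then show "cmod (c t * (exp (- s * complex_of_real t) - exp (- Complex \<alpha> (Im s) * complex_of_real t)))
          \<le> cmod (c t) * \<bar>exp (- Re s * t) - exp (- \<alpha> * t)\<bar>"
        by (simp only: norm_mult norm_of_real norm_cis mult_1_right)
    qed
    also have "h (Re s) \<le> \<epsilon>" using d s by (smt (verit) field_sum_of_halves)
    finally show "cmod (Q s - Q (Complex \<alpha> (Im s))) \<le> \<epsilon>" .
  qed (use d in simp)
qed

text \<open>
  Corrections of this shape leave \<open>\<Sum> f\<^sub>i x\<^sub>i\<close> unchanged; they are the Koszul relations.
\<close>

lemma antisymmetric_form_vanishes:
  fixes f :: "'i \<Rightarrow> complex" and A :: "'i \<Rightarrow> 'i \<Rightarrow> complex"
  assumes "\<And>i j. A j i = - A i j"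
  shows "(\<Sum>i\<in>I. f i * (\<Sum>j\<in>I. f j * A i j)) = 0"
proof -
  define S where "S = (\<Sum>i\<in>I. \<Sum>j\<in>I. f i * f j * A i j)"
  have "S = (\<Sum>j\<in>I. \<Sum>i\<in>I. f i * f j * A i j)" unfolding S_def by (rule sum.swap)
  also have "\<dots> = - S" unfolding S_def sum_negf[symmetric]
    by (intro sum.cong refl) (subst assms, simp add: mult.commute)
  finally have "S = 0" by simp
  then show ?thesis by (simp add: S_def sum_distrib_left mult.assoc)
qed

text \<open>
  The exponents range over a subgroup of the reals: all reals for almost periodic functions, the integers
  for the disc algebra. Conjugation on a line needs closure under negation.
\<close>

locale exponent_group =
  fixes G :: "real set"
  assumes zero: "0 \<in> G" and add: "t \<in> G \<Longrightarrow> u \<in> G \<Longrightarrow> t + u \<in> G"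
    and uminus: "t \<in> G \<Longrightarrow> - t \<in> G"
begin

abbreviation two_sided :: "(complex \<Rightarrow> complex) set" where
  "two_sided \<equiv> exp_polys G"

abbreviation causal :: "(complex \<Rightarrow> complex) set" where
  "causal \<equiv> exp_polys (G \<inter> {0..})"

lemma causal_subset: "causal \<subseteq> two_sided"
  using exp_polys_mono by blast

lemma bounded_algebra_vstrip: "bounded_algebra (vstrip a b) two_sided"
  by unfold_locales
    (auto intro: exp_polys_const zero exp_polys_add exp_polys_mult add exp_polys_bounded_vstrip)

lemma bounded_algebra_rhp: "bounded_algebra (rhp a) causal"
  by unfold_locales
    (auto intro: exp_polys_const zero exp_polys_add exp_polys_mult add exp_polys_bounded_rhp)

text \<open>
  On the line \<open>cnj s = 2 \<alpha> - s\<close>, so conjugating a term negates its exponent. This makes the closure over a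
  single line a C*-algebra.
\<close>

lemma unif_closure_cnj:
  assumes "f \<in> unif_closure (vstrip \<alpha> \<alpha>) two_sided"
  shows "(\<lambda>s. cnj (f s)) \<in> unif_closure (vstrip \<alpha> \<alpha>) two_sided"
proof (rule unif_closureI)
  fix \<epsilon> :: real assume "\<epsilon> > 0"
  then obtain p where p: "p \<in> two_sided" "\<And>s. s \<in> vstrip \<alpha> \<alpha> \<Longrightarrow> cmod (f s - p s) \<le> \<epsilon>"
    using unif_closureD[OF assms] by metis
  obtain T c where T: "finite T" "T \<subseteq> G" "\<And>s. p s = (\<Sum>t\<in>T. c t * exp (- s * complex_of_real t))"
    using p(1) by (rule exp_polysE) blast
  define q where "q s = (\<Sum>t\<in>T. (cnj (c t) * exp (- 2 * of_real \<alpha> * of_real t)) * exp (- s * complex_of_real (- t)))" for s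
  have "q \<in> two_sided" unfolding q_def using T(1,2) uminus
    by (intro exp_polys_sum exp_polys_monomial) auto
  moreover have "cmod (cnj (f s) - q s) \<le> \<epsilon>" if s: "s \<in> vstrip \<alpha> \<alpha>" for s
  proof -
    have cnj_s: "cnj s = 2 * of_real \<alpha> - s" using s by (auto simp: vstrip_def complex_eq_iff)
    have "cnj (exp (- s * complex_of_real t)) = exp (- 2 * of_real \<alpha> * of_real t) * exp (- s * complex_of_real (- t))" for t
    proof -
      have "cnj (exp (- s * complex_of_real t)) = exp (- cnj s * complex_of_real t)" by (simp add: exp_cnj)
      then show ?thesis unfolding cnj_s by (simp add: algebra_simps flip: exp_add)
    qed
    then have "q s = cnj (p s)" unfolding q_def T(3) cnj_sum complex_cnj_mult
      by (simp only: mult.assoc)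
    then show ?thesis using p(2)[OF s] by (metis complex_cnj_diff complex_mod_cnj)
  qed
  ultimately show "\<exists>p\<in>two_sided. \<forall>s\<in>vstrip \<alpha> \<alpha>. cmod (cnj (f s) - p s) \<le> \<epsilon>" by blast
qed

context
  fixes I :: "'i set" and f :: "'i \<Rightarrow> complex \<Rightarrow> complex" and \<delta> :: real
  assumes finI: "finite I" and f: "\<And>i. i \<in> I \<Longrightarrow> f i \<in> unif_closure (rhp 0) causal"
    and \<delta>: "\<delta> > 0" and lower: "\<And>s. s \<in> rhp 0 \<Longrightarrow> \<delta> \<le> (\<Sum>i\<in>I. cmod (f i s))"
begin

lemma I_nonempty: "I \<noteq> {}"
  using lower[of 0] \<delta> by (auto simp: rhp_def)

lemma f_uniformly_bounded:
  obtains K where "K > 0" "\<And>i s. i \<in> I \<Longrightarrow> s \<in> rhp 0 \<Longrightarrow> cmod (f i s) \<le> K"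
proof -
  have "\<exists>B. \<forall>s\<in>rhp 0. cmod (f i s) \<le> B" if "i \<in> I" for i
    using bounded_algebra.closure_bounded[OF bounded_algebra_rhp f[OF that]] by metis
  then obtain B where B: "\<And>i s. i \<in> I \<Longrightarrow> s \<in> rhp 0 \<Longrightarrow> cmod (f i s) \<le> B i" by metis
  have "cmod (f i s) \<le> 1 + (\<Sum>i\<in>I. \<bar>B i\<bar>)" if "i \<in> I" "s \<in> rhp 0" for i s
    using B[OF that] member_le_sum[of i I "\<lambda>i. \<bar>B i\<bar>"] that finI by fastforce
  moreover have "1 + (\<Sum>i\<in>I. \<bar>B i\<bar>) > 0" by (simp add: add_pos_nonneg sum_nonneg)
  ultimately show thesis using that by blast
qed

lemma sum_squares_lower_bound:
  assumes "s \<in> rhp 0"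
  shows "(\<delta> / card I)\<^sup>2 \<le> (\<Sum>i\<in>I. (cmod (f i s))\<^sup>2)"
proof -
  obtain i where i: "i \<in> I" "\<delta> / card I \<le> cmod (f i s)"
  proof (rule ccontr)
    assume "\<not> thesis"
    then have "\<And>i. i \<in> I \<Longrightarrow> cmod (f i s) < \<delta> / card I" using that by force
    then have "(\<Sum>i\<in>I. cmod (f i s)) < (\<Sum>i\<in>I. \<delta> / card I)"
      using finI I_nonempty by (intro sum_strict_mono) auto
    then show False using lower[OF assms] finI I_nonempty by simp
  qed
  have "(\<delta> / card I)\<^sup>2 \<le> (cmod (f i s))\<^sup>2" using i \<delta> by (intro power_mono) auto
  also have "\<dots> \<le> (\<Sum>i\<in>I. (cmod (f i s))\<^sup>2)" using i finI by (intro member_le_sum) auto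
  finally show ?thesis .
qed

lemma f_two_sided: "i \<in> I \<Longrightarrow> 0 \<le> a \<Longrightarrow> f i \<in> unif_closure (vstrip a b) two_sided"
  by (rule unif_closure_mono[OF f _ causal_subset]) (auto simp: vstrip_def rhp_def)

text \<open>
  The C*-algebra solution \<open>cnj f\<^sub>i / (\<Sum> |f\<^sub>j|\<^sup>2)\<close>. The denominator is positive and bounded away from \<open>0\<close>; after
  division by an upper bound \<open>M\<close> it is within distance less than \<open>1\<close> of \<open>1\<close>, so its inverse is a
  Neumann series.
\<close>

lemma bezout_on_line:
  assumes \<alpha>: "0 \<le> \<alpha>" and e: "e > 0"
  obtains X where "\<And>i. i \<in> I \<Longrightarrow> X i \<in> two_sided"
    "\<And>s. s \<in> vstrip \<alpha> \<alpha> \<Longrightarrow> cmod ((\<Sum>i\<in>I. f i s * X i s) - 1) \<le> e"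
proof -
  interpret L: bounded_algebra "vstrip \<alpha> \<alpha>" two_sided by (rule bounded_algebra_vstrip)
  have sub: "vstrip \<alpha> \<alpha> \<subseteq> rhp 0" using \<alpha> by (auto simp: vstrip_def rhp_def)
  obtain K where K: "K > 0" "\<And>i s. i \<in> I \<Longrightarrow> s \<in> rhp 0 \<Longrightarrow> cmod (f i s) \<le> K"
    using f_uniformly_bounded by metis
  define k where "k = real (card I)"
  have k: "k > 0" using finI I_nonempty by (simp add: k_def card_gt_0_iff)
  define N where "N s = (\<Sum>i\<in>I. (cmod (f i s))\<^sup>2)" for s
  define M where "M = k * K\<^sup>2"
  have M: "M > 0" using k K by (simp add: M_def)
  have N_le: "N s \<le> M" if "s \<in> rhp 0" for s
    unfolding N_def M_def k_def using K that by (intro sum_bounded_above power_mono) auto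
  have N_ge: "(\<delta> / k)\<^sup>2 \<le> N s" if "s \<in> rhp 0" for s
    unfolding N_def k_def by (rule sum_squares_lower_bound[OF that])
  define g where "g s = complex_of_real (1 / M) * (\<Sum>i\<in>I. f i s * cnj (f i s))" for s
  have g_eq: "g s = of_real (N s / M)" for s
    unfolding g_def N_def by (simp add: complex_norm_square sum_divide_distrib del: of_real_power)
  have g_cl: "g \<in> unif_closure (vstrip \<alpha> \<alpha>) two_sided"
    unfolding g_def by (intro L.closure_cmult L.closure_sum L.closure_mult unif_closure_cnj f_two_sided finI \<alpha>)
  define x where "x i s = (complex_of_real (1 / M) * cnj (f i s)) * (1 / g s)" for i s
  have x_cl: "x i \<in> unif_closure (vstrip \<alpha> \<alpha>) two_sided" if "i \<in> I" for i
    unfolding x_def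
  proof (intro L.closure_mult[OF L.closure_cmult L.closure_inverse] unif_closure_cnj f_two_sided that \<alpha> g_cl)
    show "1 - (\<delta> / k)\<^sup>2 / M < 1" using \<delta> k M by simp
    fix s assume "s \<in> vstrip \<alpha> \<alpha>"
    then have s: "s \<in> rhp 0" using sub by blast
    have "cmod (g s - 1) = \<bar>N s / M - 1\<bar>" unfolding g_eq by (metis norm_of_real of_real_1 of_real_diff)
    also have "\<dots> = 1 - N s / M" using N_le[OF s] M by simp
    also have "\<dots> \<le> 1 - (\<delta> / k)\<^sup>2 / M" using N_ge[OF s] M by (simp add: divide_right_mono)
    finally show "cmod (g s - 1) \<le> 1 - (\<delta> / k)\<^sup>2 / M" .
  qed
  have x_bezout: "(\<Sum>i\<in>I. f i s * x i s) = 1" if "s \<in> rhp 0" for s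
  proof -
    have "N s > 0" using N_ge[OF that] \<delta> k by (smt (verit) zero_less_power divide_pos_pos)
    then have "g s \<noteq> 0" using M by (simp add: g_eq)
    moreover have "(\<Sum>i\<in>I. f i s * x i s) = g s * (1 / g s)"
      unfolding x_def g_def[of s] sum_distrib_left sum_distrib_right by (simp add: algebra_simps)
    ultimately show ?thesis by simp
  qed
  have e': "e / (k * K) > 0" using e k K by simp
  have "\<exists>X. X \<in> two_sided \<and> (\<forall>s\<in>vstrip \<alpha> \<alpha>. cmod (x i s - X s) \<le> e / (k * K))" if "i \<in> I" for i
    using unif_closureD[OF x_cl[OF that] e'] by metis
  then obtain X where X: "\<And>i. i \<in> I \<Longrightarrow> X i \<in> two_sided"
    "\<And>i s. i \<in> I \<Longrightarrow> s \<in> vstrip \<alpha> \<alpha> \<Longrightarrow> cmod (x i s - X i s) \<le> e / (k * K)" by metis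
  show thesis
  proof (rule that[of X])
    fix s assume s: "s \<in> vstrip \<alpha> \<alpha>"
    then have s': "s \<in> rhp 0" using sub by blast
    have "cmod ((\<Sum>i\<in>I. f i s * X i s) - 1) \<le> k * K * (e / (k * K))"
      unfolding k_def using X(2)[OF _ s] K(2)[OF _ s']
      by (intro bezout_perturb[OF x_bezout[OF s']]) (auto simp: norm_minus_commute k_def)
    then show "cmod ((\<Sum>i\<in>I. f i s * X i s) - 1) \<le> e" using k K by simp
  qed (rule X(1))
qed

text \<open>
  The solution on the line consists of exponential polynomials, hence is defined near the line. The
  given functions are merely limits of such polynomials; approximating them on the half-plane reduces the
  claim to the horizontal continuity of a single exponential polynomial.
\<close>

lemma bezout_on_thin_strip:
  assumes \<alpha>: "0 \<le> \<alpha>"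
  obtains \<eta> where "\<eta> > 0"
    "\<And>a b. \<alpha> - \<eta> \<le> a \<Longrightarrow> 0 \<le> a \<Longrightarrow> b \<le> \<alpha> + \<eta> \<Longrightarrow> bezout_on (vstrip a b) two_sided I f"
proof -
  obtain X where X: "\<And>i. i \<in> I \<Longrightarrow> X i \<in> two_sided"
    "\<And>s. s \<in> vstrip \<alpha> \<alpha> \<Longrightarrow> cmod ((\<Sum>i\<in>I. f i s * X i s) - 1) \<le> 1 / 8"
    using bezout_on_line[OF \<alpha>, of "1 / 8"] by auto
  define k where "k = real (card I)"
  have k: "k > 0" using finI I_nonempty by (simp add: k_def card_gt_0_iff)
  have "\<exists>B. \<forall>s\<in>vstrip (\<alpha> - 1) (\<alpha> + 1). cmod (X i s) \<le> B" if "i \<in> I" for i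
    by (rule exp_polys_bounded_vstrip[OF X(1)[OF that]])
  then obtain B where B: "\<And>i s. i \<in> I \<Longrightarrow> s \<in> vstrip (\<alpha> - 1) (\<alpha> + 1) \<Longrightarrow> cmod (X i s) \<le> B i" by metis
  define C where "C = 1 + (\<Sum>i\<in>I. \<bar>B i\<bar>)"
  have C: "C > 0" by (simp add: C_def add_pos_nonneg sum_nonneg)
  have XC: "cmod (X i s) \<le> C" if "i \<in> I" "s \<in> vstrip (\<alpha> - 1) (\<alpha> + 1)" for i s
    using B[OF that] member_le_sum[of i I "\<lambda>i. \<bar>B i\<bar>"] that finI unfolding C_def by fastforce
  have e: "1 / (8 * k * C) > 0" using k C by simp
  have "\<exists>p. p \<in> causal \<and> (\<forall>s\<in>rhp 0. cmod (f i s - p s) \<le> 1 / (8 * k * C))" if "i \<in> I" for i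
    using unif_closureD[OF f[OF that] e] by metis
  then obtain p where p: "\<And>i. i \<in> I \<Longrightarrow> p i \<in> causal"
    "\<And>i s. i \<in> I \<Longrightarrow> s \<in> rhp 0 \<Longrightarrow> cmod (f i s - p i s) \<le> 1 / (8 * k * C)" by metis
  define Q where "Q s = (\<Sum>i\<in>I. p i s * X i s)" for s
  have Q: "Q \<in> two_sided"
    unfolding Q_def using X(1) p(1) causal_subset by (intro exp_polys_sum finI exp_polys_mult add) auto
  have close: "cmod ((\<Sum>i\<in>I. f i s * X i s) - Q s) \<le> 1 / 8"
    if "s \<in> rhp 0" "s \<in> vstrip (\<alpha> - 1) (\<alpha> + 1)" for s
  proof -
    have "(\<Sum>i\<in>I. f i s * X i s) - Q s = (\<Sum>i\<in>I. X i s * (f i s - p i s))"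
      unfolding Q_def by (simp add: sum_subtractf algebra_simps)
    also have "cmod \<dots> \<le> k * C * (1 / (8 * k * C))"
      unfolding k_def by (rule norm_sum_products_le) (use XC p(2) that in \<open>auto simp: k_def\<close>)
    finally show ?thesis using k C by simp
  qed
  obtain \<eta> where \<eta>: "\<eta> > 0" "\<And>s. \<bar>Re s - \<alpha>\<bar> \<le> \<eta> \<Longrightarrow> cmod (Q s - Q (Complex \<alpha> (Im s))) \<le> 1 / 8"
    using exp_polys_horizontal_continuity[OF Q, of "1 / 8" \<alpha>] by auto
  show thesis
  proof (rule that[of "min 1 \<eta>"])
    fix a b assume ab: "\<alpha> - min 1 \<eta> \<le> a" "0 \<le> a" "b \<le> \<alpha> + min 1 \<eta>"
    have "cmod ((\<Sum>i\<in>I. f i s * X i s) - 1) \<le> 1 / 2" if s: "s \<in> vstrip a b" for s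
    proof -
      define s' where "s' = Complex \<alpha> (Im s)"
      have 1: "cmod ((\<Sum>i\<in>I. f i s * X i s) - Q s) \<le> 1 / 8"
        using s ab by (intro close) (auto simp: vstrip_def rhp_def)
      have 2: "cmod (Q s - Q s') \<le> 1 / 8"
        unfolding s'_def using s ab by (intro \<eta>) (auto simp: vstrip_def abs_if)
      have 3: "cmod (Q s' - (\<Sum>i\<in>I. f i s' * X i s')) \<le> 1 / 8"
        using \<alpha> close[of s'] by (simp add: vstrip_def rhp_def s'_def norm_minus_commute)
      have 4: "cmod ((\<Sum>i\<in>I. f i s' * X i s') - 1) \<le> 1 / 8"
        by (rule X) (simp add: s'_def vstrip_def)
      have "(\<Sum>i\<in>I. f i s * X i s) - 1 = ((\<Sum>i\<in>I. f i s * X i s) - Q s) + (Q s - Q s')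
          + (Q s' - (\<Sum>i\<in>I. f i s' * X i s')) + ((\<Sum>i\<in>I. f i s' * X i s') - 1)" by simp
      also have "cmod \<dots> \<le> 1 / 8 + 1 / 8 + 1 / 8 + 1 / 8"
        by (intro norm_triangle_mono 1 2 3 4)
      finally show ?thesis by simp
    qed
    then show "bezout_on (vstrip a b) two_sided I f" by (intro bezout_onI[of I X] X(1))
  qed (use \<eta> in simp)
qed

text \<open>
  As \<open>Re s\<close> tends to infinity each function approaches its coefficient at exponent \<open>0\<close>, up to the
  approximation error. The lower bound forces one of these coefficients to be large, and its reciprocal
  solves the problem.
\<close>

lemma bezout_far_right:
  obtains R where "0 \<le> R" "bezout_on (rhp R) causal I f"
proof -
  define k where "k = real (card I)"
  have k: "k > 0" using finI I_nonempty by (simp add: k_def card_gt_0_iff)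
  define \<theta> where "\<theta> = \<delta> / k"
  have \<theta>: "\<theta> > 0" using \<delta> k by (simp add: \<theta>_def)
  have "\<exists>c. \<forall>\<^sub>F x in at_top. \<forall>s\<in>rhp x. cmod (f i s - c) \<le> \<theta> / 4" if i: "i \<in> I" for i
  proof -
    obtain p where p: "p \<in> causal" "\<And>s. s \<in> rhp 0 \<Longrightarrow> cmod (f i s - p s) \<le> \<theta> / 8"
      using unif_closureD[OF f[OF i], of "\<theta> / 8"] \<theta> by auto
    obtain T c where T: "finite T" "T \<subseteq> G \<inter> {0..}" "\<And>s. p s = (\<Sum>t\<in>T. c t * exp (- s * complex_of_real t))"
      using p(1) by (rule exp_polysE) blast
    define c0 where "c0 = (if 0 \<in> T then c 0 else 0)"
    have "((\<lambda>x::real. \<Sum>t\<in>T - {0}. cmod (c t) * exp (- x * t)) \<longlongrightarrow> 0) at_top"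
    proof (intro tendsto_null_sum tendsto_mult_right_zero)
      fix t assume "t \<in> T - {0}"
      then have "t > 0" using T(2) by force
      then show "((\<lambda>x. exp (- x * t)) \<longlongrightarrow> 0) at_top" by real_asymp
    qed
    then have "\<forall>\<^sub>F x in at_top. (\<Sum>t\<in>T - {0}. cmod (c t) * exp (- x * t)) < \<theta> / 8"
      using \<theta> by (intro order_tendstoD(2)) auto
    then have "\<forall>\<^sub>F x in at_top. \<forall>s\<in>rhp x. cmod (f i s - c0) \<le> \<theta> / 4"
      using eventually_ge_at_top[of 0]
    proof eventually_elim
      case (elim x)
      have "cmod (f i s - c0) \<le> \<theta> / 4" if s: "s \<in> rhp x" for s
      proof -
        have "p s - c0 = (\<Sum>t\<in>T - {0}. c t * exp (- s * complex_of_real t))"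
          unfolding T(3) c0_def using T(1) by (simp add: sum_diff1)
        also have "cmod \<dots> \<le> (\<Sum>t\<in>T - {0}. cmod (c t) * exp (- x * t))"
        proof (rule sum_norm_le)
          fix t assume "t \<in> T - {0}"
          then have "x * t \<le> Re s * t" using T(2) s by (intro mult_right_mono) (auto simp: rhp_def)
          then show "cmod (c t * exp (- s * complex_of_real t)) \<le> cmod (c t) * exp (- x * t)"
            by (simp add: norm_mult mult_left_mono)
        qed
        finally have "cmod (p s - c0) \<le> \<theta> / 8" using elim by simp
        moreover have "cmod (f i s - p s) \<le> \<theta> / 8" using s elim by (intro p(2)) (auto simp: rhp_def)
        ultimately show ?thesis using norm_triangle_ineq[of "f i s - p s" "p s - c0"] by simp
      qed
      then show ?case by blast
    qed
    then show ?thesis by blast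
  qed
  then have "\<forall>i\<in>I. \<exists>c. \<forall>\<^sub>F x in at_top. \<forall>s\<in>rhp x. cmod (f i s - c) \<le> \<theta> / 4" ..
  then obtain c where "\<forall>i\<in>I. \<forall>\<^sub>F x in at_top. \<forall>s\<in>rhp x. cmod (f i s - c i) \<le> \<theta> / 4"
    by (rule bchoice[THEN exE])
  then have "\<forall>\<^sub>F x in at_top. \<forall>i\<in>I. \<forall>s\<in>rhp x. cmod (f i s - c i) \<le> \<theta> / 4"
    using finI by (simp add: eventually_ball_finite_distrib)
  then have "\<forall>\<^sub>F x in at_top. 0 \<le> x \<and> (\<forall>i\<in>I. \<forall>s\<in>rhp x. cmod (f i s - c i) \<le> \<theta> / 4)"
    using eventually_ge_at_top[of 0] by eventually_elim simp
  then obtain R where R: "0 \<le> R" "\<And>i s. i \<in> I \<Longrightarrow> s \<in> rhp R \<Longrightarrow> cmod (f i s - c i) \<le> \<theta> / 4"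
    using eventually_happens'[OF trivial_limit_at_top_linorder] by blast
  have Rin: "complex_of_real R \<in> rhp R" "complex_of_real R \<in> rhp 0" using R by (auto simp: rhp_def)
  obtain i where i: "i \<in> I" "\<theta> \<le> cmod (f i R)"
  proof (rule ccontr)
    assume "\<not> thesis"
    then have "\<And>i. i \<in> I \<Longrightarrow> cmod (f i R) < \<theta>" using that by force
    then have "(\<Sum>i\<in>I. cmod (f i R)) < (\<Sum>i\<in>I. \<theta>)"
      using finI I_nonempty by (intro sum_strict_mono) auto
    then show False using lower[OF Rin(2)] k by (simp add: \<theta>_def k_def)
  qed
  have ci: "cmod (c i) \<ge> 3 * \<theta> / 4"
    using R(2)[OF i(1) Rin(1)] i(2) norm_triangle_ineq2[of "f i R" "c i"] by simp
  then have ci0: "c i \<noteq> 0" using \<theta> by auto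
  define X where "X j s = (if j = i then 1 / c i else 0)" for j and s :: complex
  have "X j \<in> causal" for j unfolding X_def using zero by (intro exp_polys_const) auto
  moreover have "cmod ((\<Sum>j\<in>I. f j s * X j s) - 1) \<le> 1 / 2" if s: "s \<in> rhp R" for s
  proof -
    have "(\<Sum>j\<in>I. f j s * X j s) = f i s / c i"
      unfolding X_def using finI i(1) by (simp add: if_distrib sum.delta cong: if_cong)
    then have "(\<Sum>j\<in>I. f j s * X j s) - 1 = (f i s - c i) / c i"
      using ci0 by (simp add: diff_divide_distrib)
    then have "cmod ((\<Sum>j\<in>I. f j s * X j s) - 1) = cmod (f i s - c i) / cmod (c i)"
      by (simp add: norm_divide)
    also have "\<dots> \<le> (\<theta> / 4) / (3 * \<theta> / 4)"
      using R(2)[OF i(1) s] ci \<theta> by (intro frac_le) auto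
    also have "\<dots> \<le> 1 / 2" using \<theta> by simp
    finally show ?thesis .
  qed
  ultimately have "bezout_on (rhp R) causal I f" by (rule bezout_onI)
  then show thesis using that R(1) by blast
qed

end

text \<open>
  A sharp cut suffices wherever no bound on the two parts is required.
\<close>

lemma exp_poly_sign_splitting:
  assumes "W \<in> two_sided"
  obtains A B where "A \<in> two_sided" "B \<in> causal" "\<And>s. W s = A s - B s"
proof -
  obtain T c where T: "finite T" "T \<subseteq> G" "\<And>s. W s = (\<Sum>t\<in>T. c t * exp (- s * complex_of_real t))"
    using assms by (rule exp_polysE) blast
  define A where "A s = (\<Sum>t\<in>T \<inter> {..<0}. c t * exp (- s * complex_of_real t))" for s
  define B where "B s = (\<Sum>t\<in>T \<inter> {0..}. - c t * exp (- s * complex_of_real t))" for s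
  have "A \<in> two_sided" unfolding A_def by (rule exp_polysI[of "T \<inter> {..<0}"]) (use T in auto)
  moreover have "B \<in> causal" unfolding B_def by (rule exp_polysI[of "T \<inter> {0..}" _ _ "\<lambda>t. - c t"]) (use T in auto)
  moreover have "W s = A s - B s" for s
  proof -
    have "W s = (\<Sum>t\<in>T \<inter> {..<0}. c t * exp (- s * complex_of_real t)) + (\<Sum>t\<in>T \<inter> {0..}. c t * exp (- s * complex_of_real t))"
      unfolding T(3) using T(1) by (subst sum.union_disjoint[symmetric]) (auto intro!: sum.cong)
    then show ?thesis by (simp add: A_def B_def sum_negf)
  qed
  ultimately show thesis using that by blast
qed

text \<open>
  Let \<open>xL\<close> and \<open>xR\<close> solve the equation exactly on the strip and on the half-plane. On the overlap
  \<open>xL\<^sub>i - xR\<^sub>i = \<Sum>\<^sub>j f\<^sub>j w\<^sub>i\<^sub>j\<close> with the antisymmetric matrix \<open>w\<^sub>i\<^sub>j = xL\<^sub>i xR\<^sub>j - xR\<^sub>i xL\<^sub>j\<close>. If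
  \<open>w \<approx> A - B\<close> with \<open>A\<close> good on the strip and \<open>B\<close> causal, then \<open>l = xL - A f\<close> and \<open>r = xR - B f\<close> are
  again exact solutions, and they nearly agree on the overlap. Exponential polynomials \<open>Lp\<close> and \<open>Rp\<close>
  approximating them have a difference that is small on the overlap, and splitting this difference as \<open>Q1 - Q2\<close>
  with bounds produces one function \<open>Lp - Q1 = Rp - Q2\<close>, which is close to \<open>l\<close> on the left, close to \<open>r\<close> on the
  right, and causal.

  The parts \<open>A\<close> and \<open>B\<close> may be large, since they disappear from the final estimate; the constant \<open>C\<close>
  of the second splitting depends only on the geometry of the strips, so the approximation error \<open>\<epsilon>\<close> can
  be chosen after it.
\<close>

lemma bezout_patching:
  assumes finI: "finite I" and f: "\<And>i. i \<in> I \<Longrightarrow> f i \<in> unif_closure (rhp 0) causal"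
    and K: "K > 0" "\<And>i s. i \<in> I \<Longrightarrow> s \<in> rhp 0 \<Longrightarrow> cmod (f i s) \<le> K"
    and ap: "0 \<le> a" "a \<le> p" and pq: "p < q"
    and left: "bezout_on (vstrip a q) two_sided I f" and right: "bezout_on (rhp p) causal I f"
  shows "bezout_on (rhp a) causal I f"
proof -
  interpret L: bounded_algebra "vstrip a q" two_sided by (rule bounded_algebra_vstrip)
  interpret R: bounded_algebra "rhp p" causal by (rule bounded_algebra_rhp)
  interpret O: bounded_algebra "vstrip p q" two_sided by (rule bounded_algebra_vstrip)
  have sub: "vstrip a q \<subseteq> rhp 0" "rhp p \<subseteq> rhp 0" "vstrip p q \<subseteq> vstrip a q" "vstrip p q \<subseteq> rhp p"
    using ap by (auto simp: vstrip_def rhp_def)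
  have fL: "f i \<in> unif_closure (vstrip a q) two_sided" if "i \<in> I" for i
    by (rule unif_closure_mono[OF f[OF that] sub(1) causal_subset])
  have fR: "f i \<in> unif_closure (rhp p) causal" if "i \<in> I" for i
    by (rule unif_closure_mono[OF f[OF that] sub(2) order_refl])
  define m where "m = (p + q) / 2"
  have m: "p < m" "m < q" using pq by (auto simp: m_def)
  obtain C where C: "C > 0" "\<And>Q B. Q \<in> two_sided \<Longrightarrow> (\<And>s. s \<in> vstrip p q \<Longrightarrow> cmod (Q s) \<le> B) \<Longrightarrow>
       \<exists>Q1 Q2. Q1 \<in> two_sided \<and> Q2 \<in> causal \<and> (\<forall>s. Q s = Q1 s - Q2 s) \<and>
         (\<forall>s\<in>vstrip a m. cmod (Q1 s) \<le> C * B) \<and> (\<forall>s\<in>rhp m. cmod (Q2 s) \<le> C * B)"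
    using exp_poly_splitting[OF m] by metis
  define k where "k = real (card I)"
  have k: "k \<ge> 0" by (simp add: k_def)
  define \<epsilon> where "\<epsilon> = 1 / (2 * (k * K + 1) * (1 + C * (k * K + 2)))"
  define \<tau> where "\<tau> = \<epsilon> + C * (k * K * \<epsilon> + 2 * \<epsilon>)"
  have kK: "k * K \<ge> 0" using k K by simp
  have \<epsilon>: "\<epsilon> > 0" unfolding \<epsilon>_def using kK C by (intro divide_pos_pos mult_pos_pos add_nonneg_pos) auto
  have \<tau>: "k * K * \<tau> \<le> 1 / 2"
  proof -
    have D: "1 + C * (k * K + 2) > 0" using C kK by (intro add_pos_nonneg) auto
    have "\<tau> = \<epsilon> * (1 + C * (k * K + 2))" unfolding \<tau>_def by (simp add: algebra_simps)
    also have "\<dots> = 1 / (2 * (k * K + 1))" unfolding \<epsilon>_def using D by simp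
    finally have "\<tau> = 1 / (2 * (k * K + 1))" .
    then have "k * K * \<tau> = (k * K) / (k * K + 1) / 2" by simp
    also have "(k * K) / (k * K + 1) \<le> 1" using kK by simp
    finally show ?thesis by simp
  qed
  obtain XL where XL: "\<And>i. i \<in> I \<Longrightarrow> XL i \<in> two_sided"
      "\<And>s. s \<in> vstrip a q \<Longrightarrow> cmod ((\<Sum>i\<in>I. f i s * XL i s) - 1) \<le> 1 / 2"
    by (rule bezout_onE[OF left]) blast
  obtain XR where XR: "\<And>i. i \<in> I \<Longrightarrow> XR i \<in> causal"
      "\<And>s. s \<in> rhp p \<Longrightarrow> cmod ((\<Sum>i\<in>I. f i s * XR i s) - 1) \<le> 1 / 2"
    by (rule bezout_onE[OF right]) blast
  define xL where "xL i s = XL i s * (1 / (\<Sum>i\<in>I. f i s * XL i s))" for i s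
  define xR where "xR i s = XR i s * (1 / (\<Sum>i\<in>I. f i s * XR i s))" for i s
  have xL_cl: "xL i \<in> unif_closure (vstrip a q) two_sided" if "i \<in> I" for i
    unfolding xL_def using XL that
    by (intro L.closure_mult L.closure_inverse[of _ "1 / 2"] L.closure_sum fL finI subset_unif_closure) auto
  have xR_cl: "xR i \<in> unif_closure (rhp p) causal" if "i \<in> I" for i
    unfolding xR_def using XR that
    by (intro R.closure_mult R.closure_inverse[of _ "1 / 2"] R.closure_sum fR finI subset_unif_closure) auto
  have xL1: "(\<Sum>i\<in>I. f i s * xL i s) = 1" if "s \<in> vstrip a q" for s
  proof -
    have "(\<Sum>i\<in>I. f i s * XL i s) \<noteq> 0" using XL(2)[OF that] by (intro notI) simp
    then show ?thesis unfolding xL_def by (simp flip: mult.assoc sum_distrib_right sum_divide_distrib)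
  qed
  have xR1: "(\<Sum>i\<in>I. f i s * xR i s) = 1" if "s \<in> rhp p" for s
  proof -
    have "(\<Sum>i\<in>I. f i s * XR i s) \<noteq> 0" using XR(2)[OF that] by (intro notI) simp
    then show ?thesis unfolding xR_def by (simp flip: mult.assoc sum_distrib_right sum_divide_distrib)
  qed
  define w where "w i j s = xL i s * xR j s - xR i s * xL j s" for i j s
  have w_cl: "w i j \<in> unif_closure (vstrip p q) two_sided" if "i \<in> I" "j \<in> I" for i j
    unfolding w_def using that
    by (intro O.closure_diff O.closure_mult unif_closure_mono[OF xL_cl sub(3)] unif_closure_mono[OF xR_cl sub(4)])
      (use causal_subset in auto)
  have "\<exists>A B. A \<in> two_sided \<and> B \<in> causal
      \<and> (\<forall>s\<in>vstrip p q. cmod (w i j s - (A s - B s)) \<le> \<epsilon>)" if ij: "i \<in> I" "j \<in> I" for i j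
  proof -
    obtain W where W: "W \<in> two_sided" "\<And>s. s \<in> vstrip p q \<Longrightarrow> cmod (w i j s - W s) \<le> \<epsilon>"
      using unif_closureD[OF w_cl[OF ij] \<epsilon>] by metis
    obtain A B where AB: "A \<in> two_sided" "B \<in> causal" "\<And>s. W s = A s - B s"
      using exp_poly_sign_splitting[OF W(1)] by metis
    show ?thesis using W(2) AB by (intro exI[of _ A] exI[of _ B]) simp
  qed
  then obtain A0 B0 where W: "\<And>i j. i \<in> I \<Longrightarrow> j \<in> I \<Longrightarrow> A0 i j \<in> two_sided"
      "\<And>i j. i \<in> I \<Longrightarrow> j \<in> I \<Longrightarrow> B0 i j \<in> causal"
      "\<And>i j s. i \<in> I \<Longrightarrow> j \<in> I \<Longrightarrow> s \<in> vstrip p q \<Longrightarrow> cmod (w i j s - (A0 i j s - B0 i j s)) \<le> \<epsilon>"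
    by metis
  \<comment> \<open>The approximations of \<open>w i j\<close> and \<open>w j i\<close> are unrelated; antisymmetry is restored by averaging.\<close>
  define A where "A i j s = (1 / 2) * (A0 i j s - A0 j i s)" for i j s
  define B where "B i j s = (1 / 2) * (B0 i j s - B0 j i s)" for i j s
  have A: "A i j \<in> two_sided" if "i \<in> I" "j \<in> I" for i j
    unfolding A_def using W(1) that zero by (intro exp_polys_mult exp_polys_const exp_polys_diff add) auto
  have B: "B i j \<in> causal" if "i \<in> I" "j \<in> I" for i j
    unfolding B_def using W(2) that zero by (intro exp_polys_mult exp_polys_const exp_polys_diff) (auto intro: add)
  have wAB: "cmod (w i j s - (A i j s - B i j s)) \<le> \<epsilon>" if "i \<in> I" "j \<in> I" "s \<in> vstrip p q" for i j s
  proof -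
    have "w i j s - (A i j s - B i j s)
        = (1 / 2) * ((w i j s - (A0 i j s - B0 i j s)) - (w j i s - (A0 j i s - B0 j i s)))"
      by (simp add: A_def B_def w_def field_simps)
    also have "cmod \<dots> \<le> (1 / 2) * (\<epsilon> + \<epsilon>)"
      unfolding norm_mult using W(3)[OF that] W(3)[OF that(2,1,3)]
        norm_triangle_ineq4[of "w i j s - (A0 i j s - B0 i j s)" "w j i s - (A0 j i s - B0 j i s)"] by simp
    finally show ?thesis by simp
  qed
  define l where "l i s = xL i s - (\<Sum>j\<in>I. f j s * A i j s)" for i s
  define r where "r i s = xR i s - (\<Sum>j\<in>I. f j s * B i j s)" for i s
  have l_cl: "l i \<in> unif_closure (vstrip a q) two_sided" if "i \<in> I" for i
    unfolding l_def using that A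
    by (intro L.closure_diff xL_cl L.closure_sum finI L.closure_mult fL subset_unif_closure) auto
  have r_cl: "r i \<in> unif_closure (rhp p) causal" if "i \<in> I" for i
    unfolding r_def using that B
    by (intro R.closure_diff xR_cl R.closure_sum finI R.closure_mult fR subset_unif_closure) auto
  have l1: "(\<Sum>i\<in>I. f i s * l i s) = 1" if "s \<in> vstrip a q" for s
    unfolding l_def right_diff_distrib sum_subtractf xL1[OF that]
    using antisymmetric_form_vanishes[of "\<lambda>i j. A i j s" "\<lambda>i. f i s" I]
    by (simp add: A_def algebra_simps)
  have r1: "(\<Sum>i\<in>I. f i s * r i s) = 1" if "s \<in> rhp p" for s
    unfolding r_def right_diff_distrib sum_subtractf xR1[OF that]
    using antisymmetric_form_vanishes[of "\<lambda>i j. B i j s" "\<lambda>i. f i s" I]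
    by (simp add: B_def algebra_simps)
  have lr: "cmod (l i s - r i s) \<le> k * K * \<epsilon>" if i: "i \<in> I" and s: "s \<in> vstrip p q" for i s
  proof -
    have "xL i s - xR i s = xL i s * (\<Sum>j\<in>I. f j s * xR j s) - xR i s * (\<Sum>j\<in>I. f j s * xL j s)"
      using xL1 xR1 s sub by (simp add: subset_iff)
    also have "\<dots> = (\<Sum>j\<in>I. f j s * w i j s)"
      unfolding w_def sum_distrib_left sum_subtractf[symmetric] by (intro sum.cong refl) (simp add: algebra_simps)
    finally have "l i s - r i s = (\<Sum>j\<in>I. f j s * (w i j s - (A i j s - B i j s)))"
      unfolding l_def r_def by (simp add: right_diff_distrib sum_subtractf)
    then show ?thesis
      using norm_sum_products_le[of I "\<lambda>j. f j s" K "\<lambda>j. w i j s - (A i j s - B i j s)" \<epsilon>]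
        K(2) wAB[OF i _ s] s sub by (auto simp: k_def)
  qed
  have "\<exists>X. X \<in> causal \<and> (\<forall>s\<in>vstrip a m. cmod (X s - l i s) \<le> \<tau>)
      \<and> (\<forall>s\<in>rhp m. cmod (X s - r i s) \<le> \<tau>)" if i: "i \<in> I" for i
  proof -
    obtain Lp where Lp: "Lp \<in> two_sided" "\<And>s. s \<in> vstrip a q \<Longrightarrow> cmod (l i s - Lp s) \<le> \<epsilon>"
      using unif_closureD[OF l_cl[OF i] \<epsilon>] by metis
    obtain Rp where Rp: "Rp \<in> causal" "\<And>s. s \<in> rhp p \<Longrightarrow> cmod (r i s - Rp s) \<le> \<epsilon>"
      using unif_closureD[OF r_cl[OF i] \<epsilon>] by metis
    have diff: "(\<lambda>s. Lp s - Rp s) \<in> two_sided"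
      using Lp(1) Rp(1) causal_subset by (intro exp_polys_diff) auto
    have small: "cmod (Lp s - Rp s) \<le> k * K * \<epsilon> + 2 * \<epsilon>" if s: "s \<in> vstrip p q" for s
    proof -
      have "s \<in> vstrip a q" "s \<in> rhp p" using s sub(3,4) by auto
      then have "cmod (l i s - Lp s) \<le> \<epsilon>" "cmod (r i s - Rp s) \<le> \<epsilon>" using Lp(2) Rp(2) by auto
      then show ?thesis
        using lr[OF i s] norm_triangle_ineq4[of "l i s - r i s" "l i s - Lp s"]
          norm_triangle_ineq[of "(l i s - r i s) - (l i s - Lp s)" "r i s - Rp s"] by simp
    qed
    obtain Q1 Q2 where Q: "Q2 \<in> causal" "\<And>s. Lp s - Rp s = Q1 s - Q2 s"
        "\<And>s. s \<in> vstrip a m \<Longrightarrow> cmod (Q1 s) \<le> C * (k * K * \<epsilon> + 2 * \<epsilon>)"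
        "\<And>s. s \<in> rhp m \<Longrightarrow> cmod (Q2 s) \<le> C * (k * K * \<epsilon> + 2 * \<epsilon>)"
      using C(2)[OF diff small] by metis
    define X where "X s = Rp s - Q2 s" for s
    have X_eq: "X s = Lp s - Q1 s" for s
      using Q(2)[of s] by (simp add: X_def algebra_simps)
    have "X \<in> causal" unfolding X_def using Rp(1) Q(1) by (intro exp_polys_diff) auto
    moreover have "cmod (X s - l i s) \<le> \<tau>" if "s \<in> vstrip a m" for s
    proof -
      have "s \<in> vstrip a q" using that m by (auto simp: vstrip_def)
      then have "cmod (l i s - Lp s) \<le> \<epsilon>" by (rule Lp(2))
      then show ?thesis unfolding \<tau>_def X_eq using Q(3)[OF that]
          norm_triangle_ineq[of "l i s - Lp s" "Q1 s"]
        by (simp add: norm_minus_commute algebra_simps)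
    qed
    moreover have "cmod (X s - r i s) \<le> \<tau>" if "s \<in> rhp m" for s
    proof -
      have "s \<in> rhp p" using that m by (auto simp: rhp_def)
      then have "cmod (r i s - Rp s) \<le> \<epsilon>" by (rule Rp(2))
      then show ?thesis unfolding \<tau>_def X_def using Q(4)[OF that]
          norm_triangle_ineq[of "r i s - Rp s" "Q2 s"]
        by (simp add: norm_minus_commute algebra_simps)
    qed
    ultimately show ?thesis by (intro exI[of _ X]) simp
  qed
  then obtain X where X: "\<And>i. i \<in> I \<Longrightarrow> X i \<in> causal"
      "\<And>i s. i \<in> I \<Longrightarrow> s \<in> vstrip a m \<Longrightarrow> cmod (X i s - l i s) \<le> \<tau>"
      "\<And>i s. i \<in> I \<Longrightarrow> s \<in> rhp m \<Longrightarrow> cmod (X i s - r i s) \<le> \<tau>" by metis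
  show ?thesis
  proof (rule bezout_onI[of I X, OF X(1)])
    fix s assume s: "s \<in> rhp a"
    have s0: "s \<in> rhp 0" using s ap by (auto simp: rhp_def)
    have "cmod ((\<Sum>i\<in>I. f i s * X i s) - 1) \<le> k * K * \<tau>"
    proof (cases "Re s \<le> m")
      case True
      then have "s \<in> vstrip a q" "s \<in> vstrip a m" using s m by (auto simp: vstrip_def rhp_def)
      then show ?thesis unfolding k_def
        by (intro bezout_perturb[OF l1] K(2) s0 X(2))
    next
      case False
      then have "s \<in> rhp p" "s \<in> rhp m" using m by (auto simp: vstrip_def rhp_def)
      then show ?thesis unfolding k_def
        by (intro bezout_perturb[OF r1] K(2) s0 X(3))
    qed
    then show "cmod ((\<Sum>i\<in>I. f i s * X i s) - 1) \<le> 1 / 2" using \<tau> by linarith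
  qed
qed

text \<open>
  The abscissas of the half-planes on which the equation is solvable have an infimum \<open>\<alpha>\<close>. A thin strip around
  \<open>Re s = \<alpha>\<close> overlaps a half-plane with a solution, and patching moves past \<open>\<alpha>\<close> unless \<open>0\<close> has been reached.
\<close>

theorem exp_corona:
  assumes finI: "finite I" and f: "\<And>i. i \<in> I \<Longrightarrow> f i \<in> unif_closure (rhp 0) causal"
    and \<delta>: "\<delta> > 0" and lower: "\<And>s. s \<in> rhp 0 \<Longrightarrow> \<delta> \<le> (\<Sum>i\<in>I. cmod (f i s))"
  shows "bezout_on (rhp 0) causal I f"
proof -
  define A where "A = {a. 0 \<le> a \<and> bezout_on (rhp a) causal I f}"
  obtain K where K: "K > 0" "\<And>i s. i \<in> I \<Longrightarrow> s \<in> rhp 0 \<Longrightarrow> cmod (f i s) \<le> K"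
    using f_uniformly_bounded[OF assms] by metis
  have ne: "A \<noteq> {}" using bezout_far_right[OF assms] unfolding A_def by auto
  have bdd: "bdd_below A" unfolding A_def by (rule bdd_belowI[of _ 0]) auto
  define \<alpha> where "\<alpha> = Inf A"
  have \<alpha>: "0 \<le> \<alpha>" unfolding \<alpha>_def using ne by (intro cInf_greatest) (auto simp: A_def)
  obtain \<eta> where \<eta>: "\<eta> > 0"
    "\<And>a b. \<alpha> - \<eta> \<le> a \<Longrightarrow> 0 \<le> a \<Longrightarrow> b \<le> \<alpha> + \<eta> \<Longrightarrow> bezout_on (vstrip a b) two_sided I f"
    using bezout_on_thin_strip[OF assms \<alpha>] by metis
  obtain p where p: "p \<in> A" "p < \<alpha> + \<eta>"
    using cInf_lessD[OF ne, of "\<alpha> + \<eta>"] \<eta>(1) unfolding \<alpha>_def by auto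
  have p\<alpha>: "\<alpha> \<le> p" unfolding \<alpha>_def by (rule cInf_lower[OF p(1) bdd])
  define a where "a = max 0 (\<alpha> - \<eta>)"
  have "bezout_on (rhp a) causal I f"
  proof (rule bezout_patching[OF finI f K, where a = a and p = p and q = "\<alpha> + \<eta>"])
    show "bezout_on (vstrip a (\<alpha> + \<eta>)) two_sided I f" by (rule \<eta>(2)) (auto simp: a_def)
  qed (use p p\<alpha> \<eta>(1) \<alpha> in \<open>auto simp: a_def A_def\<close>)
  then have "a \<in> A" by (simp add: A_def a_def)
  then have "\<alpha> \<le> a" unfolding \<alpha>_def by (rule cInf_lower[OF _ bdd])
  then have "a = 0" using \<eta>(1) by (auto simp: a_def max_def split: if_splits)
  with \<open>bezout_on (rhp a) causal I f\<close> show ?thesis by simp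
qed

end


section \<open>The algebra of causal almost periodic functions plus vanishing functions\<close>

lemma closed_rhp_eq: "closed_rhp = rhp 0"
  by (simp add: closed_rhp_def rhp_def)

lemma AP_plus_eq: "AP_plus = unif_closure closed_rhp (exp_polys (UNIV \<inter> {0..}))"
  unfolding AP_plus_def unif_closure_def exp_span_eq_exp_polys by simp

interpretation real_exponents: exponent_group UNIV
  by unfold_locales auto

interpretation AP: bounded_algebra closed_rhp "exp_polys (UNIV \<inter> {0..})"
  unfolding closed_rhp_eq by (rule real_exponents.bounded_algebra_rhp)

interpretation integer_exponents: exponent_group \<int>
  by unfold_locales auto

text \<open>
  The multipliers of \<open>A0\<close>: a function of this kind times an element of \<open>A0\<close> is in \<open>A0\<close>.
\<close>

definition bounded_analytic :: "(complex \<Rightarrow> complex) set" where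
  "bounded_analytic = {f. f holomorphic_on open_rhp \<and> continuous_on closed_rhp f \<and>
     (\<exists>B. \<forall>s\<in>closed_rhp. cmod (f s) \<le> B)}"

lemma open_open_rhp: "open open_rhp"
  unfolding open_rhp_def by (rule open_halfspace_Re_gt)

lemma open_rhp_subset: "open_rhp \<subseteq> closed_rhp"
  by (auto simp: open_rhp_def closed_rhp_def)

lemma AP_plus_bounded_analytic:
  assumes "f \<in> AP_plus"
  shows "f \<in> bounded_analytic"
proof -
  have "\<exists>p\<in>exp_polys {0..}. \<forall>s\<in>closed_rhp. cmod (f s - p s) \<le> inverse (real (Suc n))" for n
    using assms unfolding AP_plus_def exp_span_eq_exp_polys by simp
  then obtain p where p: "\<And>n. p n \<in> exp_polys {0..}"
    "\<And>n s. s \<in> closed_rhp \<Longrightarrow> cmod (f s - p n s) \<le> inverse (real (Suc n))" by metis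
  have lim: "uniform_limit closed_rhp p f sequentially"
  proof (rule uniform_limitI)
    fix e :: real assume "e > 0"
    then obtain N where N: "inverse (real (Suc N)) < e" using reals_Archimedean by blast
    show "\<forall>\<^sub>F n in sequentially. \<forall>s\<in>closed_rhp. dist (p n s) (f s) < e"
      using eventually_ge_at_top[of N]
    proof eventually_elim
      case (elim n)
      then have le: "inverse (real (Suc n)) \<le> inverse (real (Suc N))" by simp
      show ?case
      proof
        fix s assume "s \<in> closed_rhp"
        then have "cmod (f s - p n s) < e" using p(2)[of s n] le N by linarith
        then show "dist (p n s) (f s) < e" by (simp add: dist_norm norm_minus_commute)
      qed
    qed
  qed
  have hol: "p n holomorphic_on UNIV" for n
  proof -
    obtain T c where "p n = (\<lambda>s. \<Sum>t\<in>T. c t * exp (- s * complex_of_real t))"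
      using p(1)[of n] unfolding exp_polys_def by auto
    then show ?thesis by (auto intro!: holomorphic_intros)
  qed
  have "continuous_on closed_rhp f"
  proof (rule uniform_limit_theorem[OF _ lim])
    show "\<forall>\<^sub>F n in sequentially. continuous_on closed_rhp (p n)"
      using hol holomorphic_on_imp_continuous_on continuous_on_subset by (intro always_eventually) blast
  qed simp
  moreover have "f holomorphic_on open_rhp"
  proof (rule holomorphic_uniform_sequence[OF open_open_rhp])
    show "p n holomorphic_on open_rhp" for n using hol holomorphic_on_subset by blast
    fix s assume "s \<in> open_rhp"
    then obtain d where d: "d > 0" "cball s d \<subseteq> open_rhp"
      using open_open_rhp open_contains_cball by blast
    then have "uniform_limit (cball s d) p f sequentially"
      using open_rhp_subset by (intro uniform_limit_on_subset[OF lim]) auto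
    then show "\<exists>d>0. cball s d \<subseteq> open_rhp \<and> uniform_limit (cball s d) p f sequentially"
      using d by blast
  qed
  moreover have "\<exists>B. \<forall>s\<in>closed_rhp. cmod (f s) \<le> B"
    using AP.closure_bounded[of f] assms unfolding AP_plus_eq by metis
  ultimately show ?thesis by (simp add: bounded_analytic_def)
qed

lemma A0_eventually_small:
  assumes "k \<in> A0" "\<epsilon> > 0"
  obtains R where "R > 0" "\<And>s. s \<in> closed_rhp \<Longrightarrow> R \<le> cmod s \<Longrightarrow> cmod (k s) \<le> \<epsilon>"
proof -
  have "\<forall>\<^sub>F s in inf at_infinity (principal closed_rhp). dist (k s) 0 < \<epsilon>"
    using assms unfolding A0_def by (auto dest: tendstoD)
  then obtain b where b: "\<And>s. b \<le> cmod s \<Longrightarrow> s \<in> closed_rhp \<Longrightarrow> cmod (k s) < \<epsilon>"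
    unfolding eventually_inf_principal eventually_at_infinity by auto
  show thesis
    by (rule that[of "max b 1"]) (use b in \<open>auto intro: less_imp_le\<close>)
qed

lemma A0_bounded_analytic:
  assumes "k \<in> A0"
  shows "k \<in> bounded_analytic"
proof -
  have k: "k holomorphic_on open_rhp" "continuous_on closed_rhp k" using assms by (auto simp: A0_def)
  obtain R where R: "R > 0" "\<And>s. s \<in> closed_rhp \<Longrightarrow> R \<le> cmod s \<Longrightarrow> cmod (k s) \<le> 1"
    using A0_eventually_small[OF assms zero_less_one] by metis
  have "compact (closed_rhp \<inter> cball 0 R)"
    unfolding closed_rhp_def by (intro closed_Int_compact closed_halfspace_Re_ge compact_cball)
  then have "compact (k ` (closed_rhp \<inter> cball 0 R))"
    using k(2) by (intro compact_continuous_image continuous_on_subset[OF k(2)]) auto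
  then have "bounded (k ` (closed_rhp \<inter> cball 0 R))" by (rule compact_imp_bounded)
  then obtain B where "\<forall>x\<in>k ` (closed_rhp \<inter> cball 0 R). cmod x \<le> B" unfolding bounded_iff by blast
  then have B: "cmod (k s) \<le> B" if "s \<in> closed_rhp" "cmod s \<le> R" for s using that by simp
  have "cmod (k s) \<le> max 1 B" if "s \<in> closed_rhp" for s
    using B[OF that] R(2)[OF that] by (cases "cmod s \<le> R") auto
  then show ?thesis using k by (auto simp: bounded_analytic_def)
qed

lemma A0_mult_bounded_analytic:
  assumes k: "k \<in> A0" and g: "g \<in> bounded_analytic"
  shows "(\<lambda>s. k s * g s) \<in> A0"
proof -
  obtain B where B: "\<And>s. s \<in> closed_rhp \<Longrightarrow> cmod (g s) \<le> B"
    using g by (auto simp: bounded_analytic_def)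
  have "((\<lambda>s. k s * g s) \<longlongrightarrow> 0) (inf at_infinity (principal closed_rhp))"
  proof (rule tendsto_0_le)
    show "(k \<longlongrightarrow> 0) (inf at_infinity (principal closed_rhp))" using k by (simp add: A0_def)
    show "\<forall>\<^sub>F s in inf at_infinity (principal closed_rhp). cmod (k s * g s) \<le> cmod (k s) * B"
      unfolding eventually_inf_principal
      by (intro always_eventually) (auto simp: norm_mult intro!: mult_left_mono B)
  qed
  then show ?thesis using k g
    unfolding A0_def bounded_analytic_def by (auto intro!: holomorphic_intros continuous_intros)
qed

lemma A0_add: "k \<in> A0 \<Longrightarrow> l \<in> A0 \<Longrightarrow> (\<lambda>s. k s + l s) \<in> A0"
  unfolding A0_def by (auto intro!: holomorphic_intros continuous_intros tendsto_add_zero)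

lemma A0_cmult: "k \<in> A0 \<Longrightarrow> (\<lambda>s. c * k s) \<in> A0"
  unfolding A0_def by (auto intro!: holomorphic_intros continuous_intros tendsto_mult_right_zero)

lemma zero_in_A0: "(\<lambda>s. 0) \<in> A0"
  by (simp add: A0_def)

lemma A0_AP_plusI:
  assumes "g \<in> A0" "h \<in> AP_plus" "\<And>s. s \<in> closed_rhp \<Longrightarrow> f s = g s + h s"
  shows "f \<in> A0_AP_plus"
  using assms unfolding A0_AP_plus_def by blast

lemma AP_plus_subset: "f \<in> AP_plus \<Longrightarrow> f \<in> A0_AP_plus"
  by (rule A0_AP_plusI[OF zero_in_A0]) auto

lemma A0_AP_plus_add:
  assumes "f \<in> A0_AP_plus" "g \<in> A0_AP_plus"
  shows "(\<lambda>s. f s + g s) \<in> A0_AP_plus"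
proof -
  obtain f0 fA where f: "f0 \<in> A0" "fA \<in> AP_plus" "\<And>s. s \<in> closed_rhp \<Longrightarrow> f s = f0 s + fA s"
    using assms(1) by (auto simp: A0_AP_plus_def)
  obtain g0 gA where g: "g0 \<in> A0" "gA \<in> AP_plus" "\<And>s. s \<in> closed_rhp \<Longrightarrow> g s = g0 s + gA s"
    using assms(2) by (auto simp: A0_AP_plus_def)
  have "(\<lambda>s. fA s + gA s) \<in> AP_plus"
    using f(2) g(2) unfolding AP_plus_eq by (rule AP.closure_add)
  from A0_AP_plusI[OF A0_add[OF f(1) g(1)] this] show ?thesis by (simp add: f(3) g(3))
qed

lemma A0_AP_plus_mult:
  assumes "f \<in> A0_AP_plus" "g \<in> A0_AP_plus"
  shows "(\<lambda>s. f s * g s) \<in> A0_AP_plus"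
proof -
  obtain f0 fA where f: "f0 \<in> A0" "fA \<in> AP_plus" "\<And>s. s \<in> closed_rhp \<Longrightarrow> f s = f0 s + fA s"
    using assms(1) by (auto simp: A0_AP_plus_def)
  obtain g0 gA where g: "g0 \<in> A0" "gA \<in> AP_plus" "\<And>s. s \<in> closed_rhp \<Longrightarrow> g s = g0 s + gA s"
    using assms(2) by (auto simp: A0_AP_plus_def)
  have AP: "(\<lambda>s. fA s * gA s) \<in> AP_plus"
    using f(2) g(2) unfolding AP_plus_eq by (rule AP.closure_mult)
  have "(\<lambda>s. (f0 s * g0 s + f0 s * gA s) + g0 s * fA s) \<in> A0"
    using f(1,2) g(1,2) A0_bounded_analytic AP_plus_bounded_analytic
    by (intro A0_add A0_mult_bounded_analytic) auto
  from A0_AP_plusI[OF this AP] show ?thesis by (simp add: f(3) g(3) algebra_simps)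
qed

lemma A0_AP_plus_bounded:
  assumes "f \<in> A0_AP_plus"
  obtains B where "B > 0" "\<And>s. s \<in> closed_rhp \<Longrightarrow> cmod (f s) \<le> B"
proof -
  obtain f0 fA where f: "f0 \<in> A0" "fA \<in> AP_plus" "\<And>s. s \<in> closed_rhp \<Longrightarrow> f s = f0 s + fA s"
    using assms by (auto simp: A0_AP_plus_def)
  obtain B where B: "\<And>s. s \<in> closed_rhp \<Longrightarrow> cmod (f0 s) \<le> B"
    using A0_bounded_analytic[OF f(1)] by (auto simp: bounded_analytic_def)
  obtain C where C: "\<And>s. s \<in> closed_rhp \<Longrightarrow> cmod (fA s) \<le> C"
    using AP_plus_bounded_analytic[OF f(2)] by (auto simp: bounded_analytic_def)
  have "cmod (f s) \<le> \<bar>B\<bar> + \<bar>C\<bar> + 1" if "s \<in> closed_rhp" for s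
    using B[OF that] C[OF that] norm_triangle_ineq[of "f0 s" "fA s"] unfolding f(3)[OF that] by linarith
  then show thesis by (intro that[of "\<bar>B\<bar> + \<bar>C\<bar> + 1"]) auto
qed

section \<open>Almost periods and the almost periodic part\<close>

text \<open>
  Dirichlet's simultaneous approximation of the numbers \<open>K t\<close> by fractions with denominator \<open>q\<close> makes
  \<open>2 \<pi> q K t\<close> nearly a multiple of \<open>2 \<pi>\<close>. The factor \<open>K\<close> forces the almost period to be at least \<open>M\<close>.
\<close>

lemma simultaneous_almost_period:
  assumes fin: "finite T" and \<epsilon>: "\<epsilon> > 0"
  obtains \<tau> :: real where "M \<le> \<tau>" "\<And>t. t \<in> T \<Longrightarrow> cmod (cis (- (\<tau> * t)) - 1) \<le> \<epsilon>"
proof -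
  obtain h where h: "bij_betw h {0..<card T} T" using ex_bij_betw_nat_finite[OF fin] by blast
  define K where "K = max 1 M"
  obtain N :: nat where N: "2 * pi / \<epsilon> < real N" using reals_Archimedean2 by blast
  have "2 * pi / \<epsilon> > 0" using \<epsilon> by simp
  then have N0: "N > 0" using N by (cases N) auto
  obtain q p where q: "0 < q" "\<And>i. i < card T \<Longrightarrow> \<bar>of_int q * (K * h i) - of_int (p i)\<bar> < 1 / N"
    using Dirichlet_approx_simult[OF N0, of "card T" "\<lambda>i. K * h i"] by metis
  define \<tau> where "\<tau> = 2 * pi * of_int q * K"
  show thesis
  proof (rule that[of \<tau>])
    have "1 \<le> pi * of_int q" using q(1) pi_gt3 by (intro mult_ge1_I) auto
    then have "1 * K \<le> (2 * pi * of_int q) * K" by (intro mult_right_mono) (auto simp: K_def)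
    then show "M \<le> \<tau>" by (simp add: \<tau>_def K_def)
    fix t assume "t \<in> T"
    then have "t \<in> h ` {0..<card T}" using h by (simp add: bij_betw_def)
    then obtain i where i: "i < card T" "t = h i" by auto
    define r where "r = \<tau> * t - 2 * pi * of_int (p i)"
    have "r = 2 * pi * (of_int q * (K * h i) - of_int (p i))"
      by (simp add: r_def \<tau>_def i(2) algebra_simps)
    then have "\<bar>r\<bar> \<le> 2 * pi * (1 / N)"
      using q(2)[OF i(1)] by (simp only: abs_mult) (intro mult_mono, auto)
    also have "\<dots> \<le> \<epsilon>" using N N0 \<epsilon> by (simp add: field_simps)
    finally have r: "\<bar>r\<bar> \<le> \<epsilon>" .
    have "- (\<tau> * t) = - r + 2 * pi * of_int (- p i)" by (simp add: r_def)
    then have "cis (- (\<tau> * t)) = cis (- r) * cis (2 * pi * of_int (- p i))"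
      by (simp only: cis_mult)
    also have "cis (2 * pi * of_int (- p i)) = 1" by (rule cis_multiple_2pi) simp
    finally have "cmod (cis (- (\<tau> * t)) - 1) = cmod (exp (\<i> * of_real (- r)) - 1)"
      by (simp add: cis_conv_exp)
    also have "\<dots> = 2 * \<bar>sin (- r / 2)\<bar>" by (rule dist_exp_i_1)
    also have "\<dots> \<le> 2 * \<bar>- r / 2\<bar>" by (intro mult_left_mono abs_sin_x_le_abs_x) simp
    finally show "cmod (cis (- (\<tau> * t)) - 1) \<le> \<epsilon>" using r by simp
  qed
qed

lemma exp_polys_almost_period:
  assumes T: "finite T" "T \<subseteq> {0..}" "\<And>t. t \<in> T \<Longrightarrow> cmod (cis (- (\<tau> * t)) - 1) \<le> \<epsilon>"
    and s: "s \<in> closed_rhp"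
  shows "cmod ((\<Sum>t\<in>T. c t * exp (- (s + \<i> * of_real \<tau>) * complex_of_real t))
       - (\<Sum>t\<in>T. c t * exp (- s * complex_of_real t))) \<le> (\<Sum>t\<in>T. cmod (c t)) * \<epsilon>"
  unfolding sum_subtractf[symmetric] sum_distrib_right
proof (rule sum_norm_le)
  fix t assume t: "t \<in> T"
  have "exp (- (s + \<i> * of_real \<tau>) * complex_of_real t) = exp (- s * complex_of_real t) * cis (- (\<tau> * t))"
    by (simp add: cis_conv_exp algebra_simps flip: exp_add)
  then have "c t * exp (- (s + \<i> * of_real \<tau>) * complex_of_real t) - c t * exp (- s * complex_of_real t)
      = c t * (exp (- s * complex_of_real t) * (cis (- (\<tau> * t)) - 1))"
    by (simp add: algebra_simps)
  also have "cmod \<dots> \<le> cmod (c t) * (1 * \<epsilon>)"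
    unfolding norm_mult using T(2,3) t s
    by (intro mult_left_mono mult_mono) (auto simp: closed_rhp_def)
  finally show "cmod (c t * exp (- (s + \<i> * of_real \<tau>) * complex_of_real t) - c t * exp (- s * complex_of_real t))
      \<le> cmod (c t) * \<epsilon>" by simp
qed

lemma AP_plus_recurrence:
  assumes g: "g \<in> AP_plus" and h: "h \<in> AP_plus" and s: "s \<in> closed_rhp" and \<epsilon>: "\<epsilon> > 0"
  obtains \<tau> :: real where "M \<le> \<tau>" "cmod (g (s + \<i> * of_real \<tau>) - g s) \<le> \<epsilon>"
    "cmod (h (s + \<i> * of_real \<tau>) - h s) \<le> \<epsilon>"
proof -
  have e3: "\<epsilon> / 3 > 0" using \<epsilon> by simp
  obtain p where p: "p \<in> exp_polys (UNIV \<inter> {0..})" "\<And>s. s \<in> closed_rhp \<Longrightarrow> cmod (g s - p s) \<le> \<epsilon> / 3"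
    using unif_closureD[OF g[unfolded AP_plus_eq] e3] by metis
  obtain q where q: "q \<in> exp_polys (UNIV \<inter> {0..})" "\<And>s. s \<in> closed_rhp \<Longrightarrow> cmod (h s - q s) \<le> \<epsilon> / 3"
    using unif_closureD[OF h[unfolded AP_plus_eq] e3] by metis
  obtain T c where T: "finite T" "T \<subseteq> UNIV \<inter> {0..}" "\<And>s. p s = (\<Sum>t\<in>T. c t * exp (- s * complex_of_real t))"
    using p(1) by (rule exp_polysE) blast
  obtain U d where U: "finite U" "U \<subseteq> UNIV \<inter> {0..}" "\<And>s. q s = (\<Sum>t\<in>U. d t * exp (- s * complex_of_real t))"
    using q(1) by (rule exp_polysE) blast
  define C where "C = 1 + (\<Sum>t\<in>T. cmod (c t)) + (\<Sum>t\<in>U. cmod (d t))"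
  have C: "C > 0" "(\<Sum>t\<in>T. cmod (c t)) \<le> C" "(\<Sum>t\<in>U. cmod (d t)) \<le> C"
    unfolding C_def by (auto simp: add_pos_nonneg sum_nonneg add_nonneg_nonneg)
  have "\<epsilon> / (3 * C) > 0" using \<epsilon> C by simp
  then obtain \<tau> where \<tau>: "M \<le> \<tau>" "\<And>t. t \<in> T \<union> U \<Longrightarrow> cmod (cis (- (\<tau> * t)) - 1) \<le> \<epsilon> / (3 * C)"
    using simultaneous_almost_period[of "T \<union> U" "\<epsilon> / (3 * C)" M] T(1) U(1) by auto
  define s' where "s' = s + \<i> * of_real \<tau>"
  have s': "s' \<in> closed_rhp" using s by (simp add: s'_def closed_rhp_def)
  have "cmod (p s' - p s) \<le> (\<Sum>t\<in>T. cmod (c t)) * (\<epsilon> / (3 * C))"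
    unfolding T(3) s'_def using T \<tau> s by (intro exp_polys_almost_period) auto
  also have "\<dots> \<le> C * (\<epsilon> / (3 * C))" using C \<epsilon> by (intro mult_right_mono) auto
  also have "\<dots> = \<epsilon> / 3" using C by simp
  finally have pp: "cmod (p s' - p s) \<le> \<epsilon> / 3" .
  have "cmod (q s' - q s) \<le> (\<Sum>t\<in>U. cmod (d t)) * (\<epsilon> / (3 * C))"
    unfolding U(3) s'_def using U \<tau> s by (intro exp_polys_almost_period) auto
  also have "\<dots> \<le> C * (\<epsilon> / (3 * C))" using C \<epsilon> by (intro mult_right_mono) auto
  also have "\<dots> = \<epsilon> / 3" using C by simp
  finally have qq: "cmod (q s' - q s) \<le> \<epsilon> / 3" .
  have three: "cmod (a - d) \<le> \<epsilon>"
    if "cmod (a - b) \<le> \<epsilon> / 3" "cmod (b - c) \<le> \<epsilon> / 3" "cmod (d - c) \<le> \<epsilon> / 3" for a b c d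
    using that norm_triangle_ineq[of "a - b" "b - c"] norm_triangle_ineq4[of "a - c" "d - c"] by simp
  show thesis
    by (rule that[of \<tau>, OF \<tau>(1)], fold s'_def)
      (rule three[OF p(2)[OF s'] pp p(2)[OF s]] three[OF q(2)[OF s'] qq q(2)[OF s]])+
qed

text \<open>
  Far up along a suitable almost period the vanishing parts are negligible while the almost periodic
  parts have nearly returned to their values at \<open>s\<close>.
\<close>

lemma AP_parts_lower_bound:
  assumes u: "u \<in> A0" and v: "v \<in> A0" and g: "g \<in> AP_plus" and h: "h \<in> AP_plus"
    and lower: "\<And>s. s \<in> closed_rhp \<Longrightarrow> \<delta> \<le> cmod (u s + g s) + cmod (v s + h s)"
    and s: "s \<in> closed_rhp"
  shows "\<delta> \<le> cmod (g s) + cmod (h s)"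
proof (rule field_le_epsilon)
  fix e :: real assume "e > 0"
  then have e4: "e / 4 > 0" by simp
  obtain R1 where R1: "\<And>s. s \<in> closed_rhp \<Longrightarrow> R1 \<le> cmod s \<Longrightarrow> cmod (u s) \<le> e / 4"
    using A0_eventually_small[OF u e4] by metis
  obtain R2 where R2: "\<And>s. s \<in> closed_rhp \<Longrightarrow> R2 \<le> cmod s \<Longrightarrow> cmod (v s) \<le> e / 4"
    using A0_eventually_small[OF v e4] by metis
  obtain \<tau> where \<tau>: "max R1 R2 + cmod s \<le> \<tau>" "cmod (g (s + \<i> * of_real \<tau>) - g s) \<le> e / 4"
    "cmod (h (s + \<i> * of_real \<tau>) - h s) \<le> e / 4"
    using AP_plus_recurrence[OF g h s e4] by metis
  define s' where "s' = s + \<i> * of_real \<tau>"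
  have s': "s' \<in> closed_rhp" using s by (simp add: s'_def closed_rhp_def)
  have "\<bar>\<tau>\<bar> \<le> cmod s' + cmod s"
    using norm_triangle_ineq4[of s' s] by (simp add: s'_def norm_mult)
  then have "R1 \<le> cmod s'" "R2 \<le> cmod s'" using \<tau>(1) by auto
  then have "cmod (u s') \<le> e / 4" "cmod (v s') \<le> e / 4" using R1 R2 s' by auto
  moreover have "cmod (u s' + g s') \<le> cmod (u s') + (cmod (g s' - g s) + cmod (g s))"
    using norm_triangle_ineq[of "u s'" "g s'"] norm_triangle_ineq[of "g s' - g s" "g s"] by simp
  moreover have "cmod (v s' + h s') \<le> cmod (v s') + (cmod (h s' - h s) + cmod (h s))"
    using norm_triangle_ineq[of "v s'" "h s'"] norm_triangle_ineq[of "h s' - h s" "h s"] by simp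
  ultimately show "\<delta> \<le> cmod (g s) + cmod (h s) + e"
    using lower[OF s'] \<tau>(2,3) unfolding s'_def[symmetric] by linarith
qed

lemma AP_plus_corona:
  assumes g: "g \<in> AP_plus" and h: "h \<in> AP_plus" and \<delta>: "\<delta> > 0"
    and lower: "\<And>s. s \<in> closed_rhp \<Longrightarrow> \<delta> \<le> cmod (g s) + cmod (h s)"
  obtains x y where "x \<in> AP_plus" "y \<in> AP_plus"
    "\<And>s. s \<in> closed_rhp \<Longrightarrow> g s * x s + h s * y s = 1"
proof -
  define f where "f b = (if b then g else h)" for b
  have "bezout_on (rhp 0) (exp_polys (UNIV \<inter> {0..})) UNIV f"
  proof (rule real_exponents.exp_corona[OF _ _ \<delta>])
    show "f b \<in> unif_closure (rhp 0) (exp_polys (UNIV \<inter> {0..}))" for b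
      using g h unfolding f_def AP_plus_eq closed_rhp_eq by simp
    show "\<delta> \<le> (\<Sum>b\<in>UNIV. cmod (f b s))" if "s \<in> rhp 0" for s
      using lower[of s] that unfolding f_def closed_rhp_eq by (simp add: UNIV_bool add.commute)
  qed simp
  then obtain X where X: "\<And>b. X b \<in> exp_polys (UNIV \<inter> {0..})"
      "\<And>s. s \<in> closed_rhp \<Longrightarrow> cmod ((\<Sum>b\<in>UNIV. f b s * X b s) - 1) \<le> 1 / 2"
    unfolding closed_rhp_eq by (rule bezout_onE) auto
  define D where "D s = g s * X True s + h s * X False s" for s
  have X_AP: "X b \<in> AP_plus" for b unfolding AP_plus_eq by (rule subset_unif_closure[OF X(1)])
  have D: "D \<in> AP_plus" unfolding D_def using g h X_AP unfolding AP_plus_eq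
    by (intro AP.closure_add AP.closure_mult) auto
  have D1: "cmod (D s - 1) \<le> 1 / 2" if "s \<in> closed_rhp" for s
    using X(2)[OF that] by (simp add: D_def f_def UNIV_bool add.commute)
  have inv: "(\<lambda>s. 1 / D s) \<in> AP_plus"
    using D D1 unfolding AP_plus_eq by (intro AP.closure_inverse[of D "1 / 2"]) auto
  show thesis
  proof (rule that[of "\<lambda>s. X True s * (1 / D s)" "\<lambda>s. X False s * (1 / D s)"])
    show "(\<lambda>s. X True s * (1 / D s)) \<in> AP_plus" "(\<lambda>s. X False s * (1 / D s)) \<in> AP_plus"
      using inv X_AP unfolding AP_plus_eq by (intro AP.closure_mult; blast)+
    fix s assume s: "s \<in> closed_rhp"
    have "D s \<noteq> 0" using D1[OF s] by (intro notI) simp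
    moreover have "g s * (X True s * (1 / D s)) + h s * (X False s * (1 / D s)) = D s * (1 / D s)"
      unfolding D_def by (simp only: distrib_right mult.assoc)
    ultimately show "g s * (X True s * (1 / D s)) + h s * (X False s * (1 / D s)) = 1" by simp
  qed
qed

section \<open>Vanishing functions plus constants as the disc algebra\<close>

text \<open>
  The functions that correspond to the disc algebra under the Cayley transform; infinity
  corresponds to the boundary point \<open>1\<close>.
\<close>

definition A0_const :: "(complex \<Rightarrow> complex) set" where
  "A0_const = {f. \<exists>c. \<exists>k\<in>A0. \<forall>s\<in>closed_rhp. f s = c + k s}"

lemma A0_constE:
  assumes "f \<in> A0_const"
  obtains c k where "k \<in> A0" "\<And>s. s \<in> closed_rhp \<Longrightarrow> f s = c + k s"
  using assms unfolding A0_const_def by auto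

lemma A0_constI:
  assumes "k \<in> A0" "\<And>s. s \<in> closed_rhp \<Longrightarrow> f s = c + k s"
  shows "f \<in> A0_const"
  using assms unfolding A0_const_def by auto

lemma A0_const_const: "(\<lambda>s. c) \<in> A0_const"
  by (rule A0_constI[OF zero_in_A0, of _ c]) simp

lemma A0_subset_A0_const: "k \<in> A0 \<Longrightarrow> k \<in> A0_const"
  by (rule A0_constI[of k _ 0]) auto

lemma A0_const_subset:
  assumes "f \<in> A0_const" shows "f \<in> A0_AP_plus"
proof -
  obtain c k where f: "k \<in> A0" "\<And>s. s \<in> closed_rhp \<Longrightarrow> f s = c + k s"
    using assms by (rule A0_constE) blast
  have "(\<lambda>s. c) \<in> AP_plus" unfolding AP_plus_eq by (rule AP.closure_const)
  from A0_AP_plusI[OF f(1) this] show ?thesis by (simp add: f(2))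
qed

lemma A0_const_add:
  assumes "f \<in> A0_const" "g \<in> A0_const" shows "(\<lambda>s. f s + g s) \<in> A0_const"
proof -
  obtain c k where f: "k \<in> A0" "\<And>s. s \<in> closed_rhp \<Longrightarrow> f s = c + k s"
    using assms(1) by (rule A0_constE) blast
  obtain d l where g: "l \<in> A0" "\<And>s. s \<in> closed_rhp \<Longrightarrow> g s = d + l s"
    using assms(2) by (rule A0_constE) blast
  show ?thesis by (rule A0_constI[OF A0_add[OF f(1) g(1)], of _ "c + d"]) (simp add: f(2) g(2))
qed

lemma A0_const_mult:
  assumes "f \<in> A0_const" "g \<in> A0_const" shows "(\<lambda>s. f s * g s) \<in> A0_const"
proof -
  obtain c k where f: "k \<in> A0" "\<And>s. s \<in> closed_rhp \<Longrightarrow> f s = c + k s"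
    using assms(1) by (rule A0_constE) blast
  obtain d l where g: "l \<in> A0" "\<And>s. s \<in> closed_rhp \<Longrightarrow> g s = d + l s"
    using assms(2) by (rule A0_constE) blast
  have "(\<lambda>s. (c * l s + d * k s) + k s * l s) \<in> A0"
    using f(1) g(1) A0_bounded_analytic by (intro A0_add A0_cmult A0_mult_bounded_analytic) auto
  then show ?thesis by (rule A0_constI[of _ _ "c * d"]) (simp add: f(2) g(2) algebra_simps)
qed

lemma A0_const_sum:
  assumes "finite I" "\<And>i. i \<in> I \<Longrightarrow> f i \<in> A0_const"
  shows "(\<lambda>s. \<Sum>i\<in>I. f i s) \<in> A0_const"
  using assms by (induction I rule: finite_induct) (simp_all add: A0_const_add A0_const_const)

lemma A0_const_power: "f \<in> A0_const \<Longrightarrow> (\<lambda>s. f s ^ n) \<in> A0_const"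
  by (induction n) (simp_all add: A0_const_mult A0_const_const)

lemma A0_const_continuous: 
  assumes "f \<in> A0_const" shows "continuous_on closed_rhp f"
proof -
  obtain c k where f: "k \<in> A0" "\<And>s. s \<in> closed_rhp \<Longrightarrow> f s = c + k s"
    using assms by (rule A0_constE) blast
  have "continuous_on closed_rhp (\<lambda>s. c + k s)"
    using f(1) by (intro continuous_intros) (simp add: A0_def)
  then show ?thesis using f(2) by (simp cong: continuous_on_cong)
qed

text \<open>
  The constant \<open>c\<close> is the value at infinity, hence nonzero, and
  \<open>1 / (c + k) - 1 / c = - k / (c (c + k))\<close> vanishes at infinity.
\<close>

lemma A0_const_inverse:
  assumes "f \<in> A0_const" and near: "\<And>s. s \<in> closed_rhp \<Longrightarrow> cmod (f s - 1) \<le> 1 / 2"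
  shows "(\<lambda>s. 1 / f s) \<in> A0_const"
proof -
  obtain c k where f: "k \<in> A0" "\<And>s. s \<in> closed_rhp \<Longrightarrow> f s = c + k s"
    using assms(1) by (rule A0_constE) blast
  have ge: "1 / 2 \<le> cmod (f s)" if "s \<in> closed_rhp" for s
    using near[OF that] norm_triangle_ineq2[of 1 "1 - f s"] by (simp add: norm_minus_commute)
  obtain R where R: "R > 0" "\<And>s. s \<in> closed_rhp \<Longrightarrow> R \<le> cmod s \<Longrightarrow> cmod (k s) \<le> 1 / 4"
    using A0_eventually_small[OF f(1), of "1 / 4"] by auto
  have Rin: "complex_of_real R \<in> closed_rhp" using R by (simp add: closed_rhp_def)
  have "cmod (k R) \<le> 1 / 4" using R Rin by auto
  then have c0: "c \<noteq> 0" using ge[OF Rin] f(2)[OF Rin] by auto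
  have "(\<lambda>s. (- 1 / c) * (1 / (c + k s))) \<in> bounded_analytic"
  proof -
    have nz: "c + k s \<noteq> 0" if "s \<in> closed_rhp" for s using ge[OF that] f(2)[OF that] by auto
    have "cmod ((- 1 / c) * (1 / (c + k s))) \<le> cmod (1 / c) * 2" if "s \<in> closed_rhp" for s
    proof -
      have "1 / cmod (c + k s) \<le> 1 / (1 / 2)"
        using ge[OF that] unfolding f(2)[OF that] by (intro divide_left_mono) auto
      then have "cmod (1 / c) * (1 / cmod (c + k s)) \<le> cmod (1 / c) * 2" by (intro mult_left_mono) auto
      then show ?thesis by (simp add: norm_mult norm_divide)
    qed
    then show ?thesis using f(1) nz open_rhp_subset c0 unfolding bounded_analytic_def A0_def
      by (auto intro!: holomorphic_intros continuous_intros)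
  qed
  from A0_mult_bounded_analytic[OF f(1) this] show ?thesis
  proof (rule A0_constI)
    fix s assume s: "s \<in> closed_rhp"
    have "f s \<noteq> 0" using ge[OF s] by auto
    then show "1 / f s = 1 / c + k s * ((- 1 / c) * (1 / (c + k s)))"
    proof -
      have "k s = f s - c" "c + k s = f s" by (simp_all add: f(2)[OF s])
      then show ?thesis using c0 \<open>f s \<noteq> 0\<close> by (simp only:) (simp add: field_simps)
    qed
  qed
qed

text \<open>
  The dilate \<open>\<phi> (r w)\<close> is uniformly close to \<open>\<phi>\<close> by uniform continuity, and its Taylor series converges
  absolutely and uniformly on the closed disc because it converges on a larger one.
\<close>

lemma disc_algebra_polynomial_approx:
  assumes cont: "continuous_on (cball 0 1) \<phi>" and hol: "\<phi> holomorphic_on ball 0 1" and \<epsilon>: "\<epsilon> > 0"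
  obtains N a where "\<And>w. w \<in> cball 0 1 \<Longrightarrow> cmod (\<phi> w - (\<Sum>n<N. a n * w ^ n)) \<le> \<epsilon>"
proof -
  have "uniformly_continuous_on (cball 0 1) \<phi>"
    by (rule compact_uniformly_continuous[OF cont compact_cball])
  moreover have "\<epsilon> / 2 > 0" using \<epsilon> by simp
  ultimately obtain d where d: "d > 0"
      "\<And>w w'. w \<in> cball 0 1 \<Longrightarrow> w' \<in> cball 0 1 \<Longrightarrow> dist w' w < d \<Longrightarrow> dist (\<phi> w') (\<phi> w) < \<epsilon> / 2"
    unfolding uniformly_continuous_on_def by metis
  define r where "r = 1 - min (1 / 2) (d / 2)"
  have r: "1 / 2 \<le> r" "r < 1" "1 - r < d" using d(1) by (auto simp: r_def)
  define \<psi> where "\<psi> w = \<phi> (of_real r * w)" for w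
  have \<psi>: "\<psi> holomorphic_on ball 0 (1 / r)"
  proof -
    have "cmod (of_real r * w) < 1" if "cmod w < 1 / r" for w :: complex
      using that r by (simp add: norm_mult field_simps)
    then have "(\<lambda>w::complex. of_real r * w) ` ball 0 (1 / r) \<subseteq> ball 0 1" by auto
    then have "\<phi> \<circ> (\<lambda>w. of_real r * w) holomorphic_on ball 0 (1 / r)"
      by (intro holomorphic_on_compose_gen[OF _ hol]) (auto intro!: holomorphic_intros)
    then show ?thesis by (simp add: \<psi>_def[abs_def] o_def)
  qed
  define a where "a n = (deriv ^^ n) \<psi> 0 / fact n" for n
  have sums: "(\<lambda>n. a n * w ^ n) sums \<psi> w" if "w \<in> ball 0 (1 / r)" for w
    using holomorphic_power_series[OF \<psi> that] by (simp add: a_def)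
  have "1 < 1 / r" using r by simp
  then obtain \<rho> where \<rho>: "1 < \<rho>" "\<rho> < 1 / r" using dense by blast
  have "summable (\<lambda>n. a n * of_real \<rho> ^ n)"
    using sums[of "of_real \<rho>"] \<rho> by (auto simp: summable_def)
  then have "summable (\<lambda>n. cmod (a n * 1 ^ n))"
    by (rule powser_insidea) (use \<rho> in simp)
  then have "uniform_limit (cball 0 1) (\<lambda>N w. \<Sum>n<N. a n * w ^ n) (\<lambda>w. \<Sum>n. a n * w ^ n) sequentially"
    by (intro Weierstrass_m_test[of _ _ "\<lambda>n. cmod (a n * 1 ^ n)"])
       (auto simp: norm_mult norm_power intro!: mult_left_le power_le_one)
  then obtain N where N: "\<And>w. w \<in> cball 0 1 \<Longrightarrow> dist (\<Sum>n<N. a n * w ^ n) (\<Sum>n. a n * w ^ n) < \<epsilon> / 2"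
    using uniform_limitD[of _ _ _ _ "\<epsilon> / 2"] \<open>\<epsilon> / 2 > 0\<close> eventually_happens'[OF sequentially_bot] by blast
  show thesis
  proof (rule that[of a N])
    fix w :: complex assume w: "w \<in> cball 0 1"
    have "w \<in> ball 0 (1 / r)" using w \<open>1 < 1 / r\<close> by auto
    then have "(\<Sum>n. a n * w ^ n) = \<psi> w" using sums sums_unique by metis
    then have 1: "cmod (\<psi> w - (\<Sum>n<N. a n * w ^ n)) < \<epsilon> / 2"
      using N[OF w] by (simp add: dist_norm norm_minus_commute)
    have "cmod (of_real r * w) \<le> 1 * 1"
      unfolding norm_mult using w r by (intro mult_mono) auto
    then have "of_real r * w \<in> cball 0 1" by simp
    moreover have "dist (of_real r * w) w < d"
    proof -
      have "of_real r * w - w = of_real (r - 1) * w" by (simp add: algebra_simps)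
      then have "dist (of_real r * w) w = (1 - r) * cmod w"
        unfolding dist_norm using r by (simp only: norm_mult norm_of_real) simp
      also have "\<dots> \<le> (1 - r) * 1" using w r by (intro mult_left_mono) auto
      finally show ?thesis using r by simp
    qed
    ultimately have "dist (\<phi> (of_real r * w)) (\<phi> w) < \<epsilon> / 2" using d(2) w by blast
    then have 2: "cmod (\<phi> w - \<psi> w) < \<epsilon> / 2" by (simp add: \<psi>_def dist_norm norm_minus_commute)
    show "cmod (\<phi> w - (\<Sum>n<N. a n * w ^ n)) \<le> \<epsilon>"
      using 1 2 norm_triangle_ineq[of "\<phi> w - \<psi> w" "\<psi> w - (\<Sum>n<N. a n * w ^ n)"] by simp
  qed
qed

definition cayley_inv :: "complex \<Rightarrow> complex" where
  "cayley_inv w = (1 + w) / (1 - w)"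

definition cayley :: "complex \<Rightarrow> complex" where
  "cayley z = (z - 1) / (z + 1)"

lemma Re_cayley_inv: "Re (cayley_inv w) = (1 - (cmod w)\<^sup>2) / (cmod (1 - w))\<^sup>2"
proof -
  have "cayley_inv w = (1 + w) * cnj (1 - w) / of_real ((cmod (1 - w))\<^sup>2)"
    unfolding cayley_inv_def by (subst complex_div_cnj) simp
  moreover have "Re ((1 + w) * cnj (1 - w)) = 1 - (cmod w)\<^sup>2"
    unfolding cmod_power2 by (simp add: algebra_simps power2_eq_square)
  ultimately show ?thesis by (simp only: Re_divide_of_real)
qed

lemma cayley_props:
  assumes "z \<in> closed_rhp"
  shows "cmod (cayley z) \<le> 1" "cayley z \<noteq> 1" "cayley_inv (cayley z) = z"
proof -
  have nz: "z + 1 \<noteq> 0" using assms by (auto simp: closed_rhp_def complex_eq_iff)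
  have "(cmod (z - 1))\<^sup>2 \<le> (cmod (z + 1))\<^sup>2"
    using assms unfolding cmod_power2 by (simp add: closed_rhp_def power2_eq_square algebra_simps)
  then have "cmod (z - 1) \<le> cmod (z + 1)" by (rule power2_le_imp_le) simp
  then show "cmod (cayley z) \<le> 1" using nz by (simp add: cayley_def norm_divide divide_le_eq)
  have one: "1 - cayley z = 2 / (z + 1)" "1 + cayley z = 2 * z / (z + 1)"
    using nz by (simp_all add: cayley_def field_simps)
  then show "cayley z \<noteq> 1" using nz by (metis divide_eq_0_iff right_minus_eq zero_neq_numeral)
  show "cayley_inv (cayley z) = z" unfolding cayley_inv_def one using nz by simp
qed

lemma reciprocal_in_A0: "(\<lambda>s. 1 / (s + 1)) \<in> A0"
proof -
  have nz: "s + 1 \<noteq> 0" if "s \<in> closed_rhp" for s using that by (auto simp: closed_rhp_def complex_eq_iff)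
  have "((\<lambda>s::complex. 1 / (s + 1)) \<longlongrightarrow> 0) at_infinity"
    by (intro tendsto_divide_0[OF tendsto_const]
        tendsto_add_filterlim_at_infinity'[OF filterlim_ident tendsto_const])
  then have "((\<lambda>s::complex. 1 / (s + 1)) \<longlongrightarrow> 0) (inf at_infinity (principal closed_rhp))"
    by (rule tendsto_mono[rotated]) simp
  then show ?thesis unfolding A0_def using nz open_rhp_subset
    by (auto intro!: holomorphic_intros continuous_intros)
qed

lemma cayley_in_A0_const: "cayley \<in> A0_const"
proof (rule A0_constI[OF A0_cmult[OF reciprocal_in_A0], of _ 1 "- 2"])
  fix s assume "s \<in> closed_rhp"
  then have "s + 1 \<noteq> 0" by (auto simp: closed_rhp_def complex_eq_iff)
  then show "cayley s = 1 + - 2 * (1 / (s + 1))" by (simp add: cayley_def field_simps)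
qed

text \<open>
  At the boundary point \<open>1\<close> the division in \<open>cayley_inv\<close> returns the default value \<open>0\<close>,
  so the limit value \<open>0\<close> of the function has to be put in by hand.
\<close>

lemma A0_pullback_disc_algebra:
  assumes "k \<in> A0"
  defines "\<phi> \<equiv> \<lambda>w. if w = 1 then 0 else k (cayley_inv w)"
  shows "continuous_on (cball 0 1) \<phi>" "\<phi> holomorphic_on ball 0 1"
proof -
  have k: "k holomorphic_on open_rhp" "continuous_on closed_rhp k" using assms by (auto simp: A0_def)
  have maps: "cayley_inv w \<in> closed_rhp" if "w \<in> cball 0 1" for w
    using that unfolding closed_rhp_def by (simp add: Re_cayley_inv power_le_one)
  have maps': "cayley_inv w \<in> open_rhp" if "w \<in> ball 0 1" for w
  proof -
    have "(cmod w)\<^sup>2 < 1" "1 - w \<noteq> 0" using that by (auto simp: power_less_one_iff abs_square_less_1)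
    then show ?thesis unfolding open_rhp_def by (simp add: Re_cayley_inv)
  qed
  have "(\<lambda>w. k (cayley_inv w)) holomorphic_on ball 0 1"
  proof -
    have "k \<circ> cayley_inv holomorphic_on ball 0 1"
      using maps' by (intro holomorphic_on_compose_gen[OF _ k(1)])
        (auto simp: cayley_inv_def[abs_def] intro!: holomorphic_intros)
    then show ?thesis by (simp add: o_def)
  qed
  then show "\<phi> holomorphic_on ball 0 1"
    by (rule holomorphic_transform) (auto simp: \<phi>_def)
  have cont': "continuous_on (cball 0 1 - {1}) \<phi>"
  proof -
    have "continuous_on (cball 0 1 - {1}) (\<lambda>w. k (cayley_inv w))"
      using maps by (intro continuous_on_compose2[OF k(2)])
        (auto simp: cayley_inv_def[abs_def] intro!: continuous_intros)
    then show ?thesis by (rule continuous_on_eq) (auto simp: \<phi>_def)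
  qed
  show "continuous_on (cball 0 1) \<phi>"
    unfolding continuous_on_eq_continuous_within
  proof
    fix w :: complex assume w: "w \<in> cball 0 1"
    show "continuous (at w within cball 0 1) \<phi>"
    proof (cases "w = 1")
      case False
      have "at w within cball 0 1 = at w within (cball 0 1 - {1})"
        by (rule at_within_nhd[of w "- {1}"]) (use False in auto)
      then show ?thesis
        using cont' w False by (simp add: continuous_on_eq_continuous_within)
    next
      case True
      have "\<exists>d>0. \<forall>x\<in>cball 0 1. dist x 1 < d \<longrightarrow> dist (\<phi> x) (\<phi> 1) < e" if e: "e > 0" for e
      proof -
        obtain R where R: "R > 0" "\<And>s. s \<in> closed_rhp \<Longrightarrow> R \<le> cmod s \<Longrightarrow> cmod (k s) \<le> e / 2"
          using A0_eventually_small[OF assms(1), of "e / 2"] e by auto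
        have "dist (\<phi> x) (\<phi> 1) < e" if x: "x \<in> cball 0 1" "dist x 1 < min 1 (1 / R)" for x
        proof (cases "x = 1")
          case False
          have small: "cmod (1 - x) < 1" "cmod (1 - x) < 1 / R"
            using x(2) by (auto simp: dist_norm norm_minus_commute)
          have "1 \<le> cmod (1 + x)"
            using small(1) norm_triangle_ineq4[of 2 "1 - x"] norm_triangle_ineq2[of 2 "1 - x"] by simp
          moreover have "R * cmod (1 - x) \<le> 1" using small(2) R(1) by (simp add: field_simps)
          moreover have "cmod (1 - x) > 0" using False by simp
          ultimately have "R \<le> cmod (cayley_inv x)"
            by (simp add: cayley_inv_def norm_divide pos_le_divide_eq)
          then have "cmod (k (cayley_inv x)) \<le> e / 2" by (rule R(2)[OF maps[OF x(1)]])
          then show ?thesis using False e by (simp add: \<phi>_def)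
        qed (use e in simp)
        then show ?thesis using R(1) by (intro exI[of _ "min 1 (1 / R)"]) auto
      qed
      then show ?thesis unfolding True continuous_within_eps_delta by blast
    qed
  qed
qed

lemma exp_Ints_eq_power:
  assumes "t \<in> \<int> \<inter> {0..}"
  shows "exp (- s * complex_of_real t) = exp (- s) ^ nat \<lfloor>t\<rfloor>"
proof -
  have t: "t = real (nat \<lfloor>t\<rfloor>)" using assms by (auto elim!: Ints_cases)
  have "exp (- s * complex_of_real (real (nat \<lfloor>t\<rfloor>))) = exp (- s) ^ nat \<lfloor>t\<rfloor>"
    using exp_of_nat_mult[of "nat \<lfloor>t\<rfloor>" "- s"] by (simp add: mult.commute)
  then show ?thesis using t by simp
qed

text \<open>
  Substituting \<open>w = exp (- s)\<close> turns polynomials in \<open>w\<close> into causal exponential polynomials with integer exponents.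
\<close>

lemma A0_pullback_periodic:
  assumes "k \<in> A0"
  shows "(\<lambda>s. c + (if exp (- s) = 1 then 0 else k (cayley_inv (exp (- s)))))
           \<in> unif_closure (rhp 0) (exp_polys (\<int> \<inter> {0..}))"
proof (rule unif_closureI)
  fix \<epsilon> :: real assume \<epsilon>: "\<epsilon> > 0"
  define \<phi> where "\<phi> w = (if w = 1 then 0 else k (cayley_inv w))" for w
  obtain N a where a: "\<And>w. w \<in> cball 0 1 \<Longrightarrow> cmod (\<phi> w - (\<Sum>n<N. a n * w ^ n)) \<le> \<epsilon>"
    using disc_algebra_polynomial_approx[OF A0_pullback_disc_algebra[OF assms] \<epsilon>]
    unfolding \<phi>_def by metis
  define p where "p s = c + (\<Sum>n<N. a n * exp (- s * complex_of_real (real n)))" for s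
  have "p \<in> exp_polys (\<int> \<inter> {0..})"
    unfolding p_def by (intro exp_polys_add exp_polys_const exp_polys_sum exp_polys_monomial) auto
  moreover have "cmod ((c + \<phi> (exp (- s))) - p s) \<le> \<epsilon>" if "s \<in> rhp 0" for s
  proof -
    have "exp (- s) \<in> cball 0 1" using that by (simp add: rhp_def)
    moreover have "exp (- s * complex_of_real (real n)) = exp (- s) ^ n" for n
      using exp_of_nat_mult[of n "- s"] by (simp add: mult.commute)
    ultimately show ?thesis using a[of "exp (- s)"] by (simp add: p_def)
  qed
  ultimately show "\<exists>p\<in>exp_polys (\<int> \<inter> {0..}). \<forall>s\<in>rhp 0.
      cmod (c + (if exp (- s) = 1 then 0 else k (cayley_inv (exp (- s)))) - p s) \<le> \<epsilon>"
    unfolding \<phi>_def by blast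
qed

text \<open>
  This is the corona theorem for finitely many functions of the disc algebra. Reading the disc through \<open>w = exp (- s)\<close>
  reduces it to \<open>exp_corona\<close> with integer exponents, and the resulting polynomials in \<open>w\<close> return to the half-plane as polynomials
  in the Cayley transform. The exponential misses \<open>w = 0\<close>, that is the point \<open>1\<close> of the half-plane, where
  the estimate follows by continuity; the boundary point \<open>w = 1\<close> is hit, for instance by \<open>s = 0\<close>, and requires the lower bound
  for the values at infinity.
\<close>

lemma A0_const_corona:
  assumes finI: "finite I" and f: "\<And>i. i \<in> I \<Longrightarrow> f i \<in> A0_const" and \<delta>: "\<delta> > 0"
    and lower: "\<And>s. s \<in> closed_rhp \<Longrightarrow> \<delta> \<le> (\<Sum>i\<in>I. cmod (f i s))"
  obtains \<alpha> where "\<And>i. i \<in> I \<Longrightarrow> \<alpha> i \<in> A0_const"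
    "\<And>s. s \<in> closed_rhp \<Longrightarrow> (\<Sum>i\<in>I. f i s * \<alpha> i s) = 1"
proof -
  have "\<exists>c k. k \<in> A0 \<and> (\<forall>s\<in>closed_rhp. f i s = c + k s)" if "i \<in> I" for i
    using f[OF that] by (auto simp: A0_const_def)
  then obtain c k where k: "\<And>i. i \<in> I \<Longrightarrow> k i \<in> A0"
    "\<And>i s. i \<in> I \<Longrightarrow> s \<in> closed_rhp \<Longrightarrow> f i s = c i + k i s" by metis
  have lower_c: "\<delta> \<le> (\<Sum>i\<in>I. cmod (c i))"
  proof (rule field_le_epsilon)
    fix e :: real assume e: "e > 0"
    define e' where "e' = e / (real (card I) + 1)"
    have e': "e' > 0" using e by (simp add: e'_def)
    have "\<exists>R. \<forall>s\<in>closed_rhp. R \<le> cmod s \<longrightarrow> cmod (k i s) \<le> e'" if "i \<in> I" for i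
      using A0_eventually_small[OF k(1)[OF that] e'] by metis
    then obtain R where R: "\<And>i s. i \<in> I \<Longrightarrow> s \<in> closed_rhp \<Longrightarrow> R i \<le> cmod s \<Longrightarrow> cmod (k i s) \<le> e'"
      by metis
    define r where "r = (\<Sum>i\<in>I. \<bar>R i\<bar>)"
    have r: "complex_of_real r \<in> closed_rhp" "R i \<le> cmod (of_real r)" if "i \<in> I" for i
    proof -
      have "\<bar>R i\<bar> \<le> r" unfolding r_def using finI that by (intro member_le_sum) auto
      then show "complex_of_real r \<in> closed_rhp" "R i \<le> cmod (of_real r)" by (auto simp: closed_rhp_def)
    qed
    have r0: "complex_of_real r \<in> closed_rhp" by (simp add: closed_rhp_def r_def sum_nonneg)
    have "\<delta> \<le> (\<Sum>i\<in>I. cmod (f i r))" by (rule lower[OF r0])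
    also have "\<dots> \<le> (\<Sum>i\<in>I. cmod (c i) + e')"
    proof (rule sum_mono)
      fix i assume i: "i \<in> I"
      show "cmod (f i r) \<le> cmod (c i) + e'"
        unfolding k(2)[OF i r0] using R[OF i r(1,2)[OF i]] norm_triangle_ineq[of "c i" "k i r"] by linarith
    qed
    also have "\<dots> = (\<Sum>i\<in>I. cmod (c i)) + real (card I) * e'" by (simp add: sum.distrib)
    also have "real (card I) * e' \<le> e" using e by (simp add: e'_def field_simps)
    finally show "\<delta> \<le> (\<Sum>i\<in>I. cmod (c i)) + e" by simp
  qed
  define F where "F i s = c i + (if exp (- s) = 1 then 0 else k i (cayley_inv (exp (- s))))" for i s
  have "bezout_on (rhp 0) (exp_polys (\<int> \<inter> {0..})) I F"
  proof (rule integer_exponents.exp_corona[OF finI _ \<delta>])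
    show "F i \<in> unif_closure (rhp 0) (exp_polys (\<int> \<inter> {0..}))" if "i \<in> I" for i
      unfolding F_def by (rule A0_pullback_periodic[OF k(1)[OF that]])
    fix s assume "s \<in> rhp 0"
    then have w: "cmod (exp (- s)) \<le> 1" by (simp add: rhp_def)
    show "\<delta> \<le> (\<Sum>i\<in>I. cmod (F i s))"
    proof (cases "exp (- s) = 1")
      case True
      then show ?thesis using lower_c by (simp add: F_def)
    next
      case False
      have "cayley_inv (exp (- s)) \<in> closed_rhp"
        using w power_le_one[OF norm_ge_zero w, of 2] unfolding closed_rhp_def by (simp add: Re_cayley_inv del: norm_exp_eq_Re)
      then show ?thesis using lower[of "cayley_inv (exp (- s))"] k(2) False by (simp add: F_def)
    qed
  qed
  then obtain X where X: "\<And>i. i \<in> I \<Longrightarrow> X i \<in> exp_polys (\<int> \<inter> {0..})"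
      "\<And>s. s \<in> rhp 0 \<Longrightarrow> cmod ((\<Sum>i\<in>I. F i s * X i s) - 1) \<le> 1 / 2"
    by (rule bezout_onE) blast
  have "\<exists>\<beta>\<in>A0_const. \<forall>z s. exp (- s) = cayley z \<longrightarrow> \<beta> z = X i s" if i: "i \<in> I" for i
  proof -
    obtain T b where T: "finite T" "T \<subseteq> \<int> \<inter> {0..}" "\<And>s. X i s = (\<Sum>t\<in>T. b t * exp (- s * complex_of_real t))"
      using X(1)[OF i] by (rule exp_polysE) blast
    have "(\<lambda>z. \<Sum>t\<in>T. b t * cayley z ^ nat \<lfloor>t\<rfloor>) \<in> A0_const"
      by (intro A0_const_sum A0_const_mult A0_const_const A0_const_power cayley_in_A0_const T)
    moreover have "(\<Sum>t\<in>T. b t * cayley z ^ nat \<lfloor>t\<rfloor>) = X i s" if "exp (- s) = cayley z" for z s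
      unfolding T(3) using T(2) that by (intro sum.cong refl) (simp only: exp_Ints_eq_power[OF subsetD[OF T(2)]])
    ultimately show ?thesis by (intro bexI[of _ "\<lambda>z. \<Sum>t\<in>T. b t * cayley z ^ nat \<lfloor>t\<rfloor>"]) auto
  qed
  then obtain \<beta> where \<beta>: "\<And>i. i \<in> I \<Longrightarrow> \<beta> i \<in> A0_const"
      "\<And>i z s. i \<in> I \<Longrightarrow> exp (- s) = cayley z \<Longrightarrow> \<beta> i z = X i s" by metis
  define D where "D z = (\<Sum>i\<in>I. f i z * \<beta> i z)" for z
  have D: "D \<in> A0_const" unfolding D_def using f \<beta>(1) by (intro A0_const_sum A0_const_mult finI) auto
  have off_one: "cmod (D z - 1) \<le> 1 / 2" if z: "z \<in> closed_rhp" "z \<noteq> 1" for z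
  proof -
    have "z + 1 \<noteq> 0" using z(1) by (auto simp: closed_rhp_def complex_eq_iff)
    then have nz: "cayley z \<noteq> 0" using z(2) by (simp add: cayley_def)
    define s where "s = - Ln (cayley z)"
    have s: "exp (- s) = cayley z" using nz by (simp add: s_def)
    have "Re s \<ge> 0" using nz cayley_props(1)[OF z(1)] by (simp add: s_def)
    then have "cmod ((\<Sum>i\<in>I. F i s * X i s) - 1) \<le> 1 / 2" by (intro X(2)) (simp add: rhp_def)
    also have "(\<Sum>i\<in>I. F i s * X i s) = D z"
      unfolding D_def F_def using cayley_props[OF z(1)] k(2) z(1) \<beta>(2)[OF _ s]
      by (intro sum.cong refl) (simp add: s)
    finally show ?thesis .
  qed
  have near: "cmod (D z - 1) \<le> 1 / 2" if z: "z \<in> closed_rhp" for z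
  proof (rule continuous_on_closure_norm_le[of "closed_rhp - {1}" "\<lambda>z. D z - 1"])
    have sub: "closure (closed_rhp - {1}) \<subseteq> closed_rhp"
      unfolding closed_rhp_def by (intro closure_minimal closed_halfspace_Re_ge) auto
    show "continuous_on (closure (closed_rhp - {1})) (\<lambda>z. D z - 1)"
      by (intro continuous_intros continuous_on_subset[OF A0_const_continuous[OF D] sub])
    show "\<forall>y\<in>closed_rhp - {1}. cmod (D y - 1) \<le> 1 / 2" using off_one by auto
    have "1 islimpt closed_rhp"
      using open_open_rhp open_rhp_subset
      by (intro islimpt_subset[OF interior_limit_point]) (auto simp: interior_open open_rhp_def)
    then have "1 \<in> closure (closed_rhp - {1})" by (simp add: islimpt_in_closure)
    then show "z \<in> closure (closed_rhp - {1})" using z closure_subset[of "closed_rhp - {1}"] by (cases "z = 1") auto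
  qed
  have inv: "(\<lambda>s. 1 / D s) \<in> A0_const" by (rule A0_const_inverse[OF D near])
  show thesis
  proof (rule that[of "\<lambda>i s. \<beta> i s * (1 / D s)"])
    show "(\<lambda>s. \<beta> i s * (1 / D s)) \<in> A0_const" if "i \<in> I" for i
      by (rule A0_const_mult[OF \<beta>(1)[OF that] inv])
    fix s assume s: "s \<in> closed_rhp"
    have "D s \<noteq> 0" using near[OF s] by (intro notI) simp
    moreover have "(\<Sum>i\<in>I. f i s * (\<beta> i s * (1 / D s))) = D s * (1 / D s)"
      unfolding D_def by (simp only: sum_distrib_right mult.assoc)
    ultimately show "(\<Sum>i\<in>I. f i s * (\<beta> i s * (1 / D s))) = 1" by simp
  qed
qed

section \<open>The corona theorem for the full algebra\<close>

text \<open>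
  From \<open>(1 + h) \<alpha>\<^sub>0 + n z \<alpha>\<^sub>1 + d z \<alpha>\<^sub>2 = 1\<close> and \<open>1 + h = n xA + d yA\<close> the solution is read off as
  \<open>x = \<alpha>\<^sub>0 xA + z \<alpha>\<^sub>1\<close> and \<open>y = \<alpha>\<^sub>0 yA + z \<alpha>\<^sub>2\<close>. The factor \<open>z\<close> removes the almost periodic behaviour of \<open>n\<close> and \<open>d\<close> at
  infinity, where \<open>1 + h\<close> is bounded below instead.
\<close>

lemma A0_AP_plus_corona:
  assumes "n \<in> A0_AP_plus" "d \<in> A0_AP_plus" and \<delta>: "\<delta> > 0"
    and lower: "\<And>s. s \<in> closed_rhp \<Longrightarrow> \<delta> \<le> cmod (n s) + cmod (d s)"
  obtains x y where "x \<in> A0_AP_plus" "y \<in> A0_AP_plus"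
    "\<And>s. s \<in> closed_rhp \<Longrightarrow> n s * x s + d s * y s = 1"
proof -
  obtain n0 nA where n: "n0 \<in> A0" "nA \<in> AP_plus" "\<And>s. s \<in> closed_rhp \<Longrightarrow> n s = n0 s + nA s"
    using assms(1) by (auto simp: A0_AP_plus_def)
  obtain d0 dA where d: "d0 \<in> A0" "dA \<in> AP_plus" "\<And>s. s \<in> closed_rhp \<Longrightarrow> d s = d0 s + dA s"
    using assms(2) by (auto simp: A0_AP_plus_def)
  have "\<delta> \<le> cmod (nA s) + cmod (dA s)" if "s \<in> closed_rhp" for s
    using lower n(3) d(3) by (intro AP_parts_lower_bound[OF n(1) d(1) n(2) d(2) _ that]) auto
  then obtain xA yA where A: "xA \<in> AP_plus" "yA \<in> AP_plus"
      "\<And>s. s \<in> closed_rhp \<Longrightarrow> nA s * xA s + dA s * yA s = 1"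
    using AP_plus_corona[OF n(2) d(2) \<delta>] by metis
  define h where "h s = n0 s * xA s + d0 s * yA s" for s
  have h: "h \<in> A0" unfolding h_def using n d A AP_plus_bounded_analytic
    by (intro A0_add A0_mult_bounded_analytic) auto
  have one_h: "n s * xA s + d s * yA s = 1 + h s" if "s \<in> closed_rhp" for s
    using A(3)[OF that] unfolding n(3)[OF that] d(3)[OF that] h_def by (simp add: algebra_simps)
  define z where "z s = 1 / (s + 1)" for s :: complex
  have z: "z \<in> A0" unfolding z_def by (rule reciprocal_in_A0)
  have nz: "s + 1 \<noteq> 0" if "s \<in> closed_rhp" for s :: complex
    using that by (auto simp: closed_rhp_def complex_eq_iff)
  have mult_z: "(\<lambda>s. f s * z s) \<in> A0_const" if "f \<in> A0_AP_plus" for f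
  proof -
    obtain f0 fA where f: "f0 \<in> A0" "fA \<in> AP_plus" "\<And>s. s \<in> closed_rhp \<Longrightarrow> f s = f0 s + fA s"
      using \<open>f \<in> A0_AP_plus\<close> by (auto simp: A0_AP_plus_def)
    have "(\<lambda>s. z s * f0 s + z s * fA s) \<in> A0"
      using z f A0_bounded_analytic AP_plus_bounded_analytic by (intro A0_add A0_mult_bounded_analytic) auto
    then show ?thesis by (rule A0_constI[of _ _ 0]) (simp add: f(3) algebra_simps)
  qed
  define f where "f i s = (if i = (0::nat) then 1 + h s else if i = 1 then n s * z s else d s * z s)" for i s
  have sum3: "(\<Sum>i\<in>{0, 1, 2::nat}. u i) = u 0 + u 1 + u 2" for u :: "nat \<Rightarrow> 'b::comm_monoid_add"
    by (simp add: add.assoc)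
  obtain R where R: "R > 0" "\<And>s. s \<in> closed_rhp \<Longrightarrow> R \<le> cmod s \<Longrightarrow> cmod (h s) \<le> 1 / 2"
    using A0_eventually_small[OF h, of "1 / 2"] by auto
  obtain \<alpha> where \<alpha>: "\<And>i. i \<in> {0, 1, 2} \<Longrightarrow> \<alpha> i \<in> A0_const"
      "\<And>s. s \<in> closed_rhp \<Longrightarrow> (\<Sum>i\<in>{0, 1, 2}. f i s * \<alpha> i s) = 1"
  proof (rule A0_const_corona[of "{0, 1, 2}" f "min (1 / 2) (\<delta> / (R + 1))"])
    show "f i \<in> A0_const" if "i \<in> {0, 1, 2}" for i
    proof -
      have "(\<lambda>s. 1 + h s) \<in> A0_const" by (rule A0_constI[OF h]) simp
      then show ?thesis unfolding f_def using that mult_z[OF assms(1)] mult_z[OF assms(2)] by auto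
    qed
    show "0 < min (1 / 2) (\<delta> / (R + 1))" using \<delta> R by simp
    fix s assume s: "s \<in> closed_rhp"
    have sum_eq: "(\<Sum>i\<in>{0, 1, 2}. cmod (f i s)) = cmod (1 + h s) + (cmod (n s) + cmod (d s)) * cmod (z s)"
      unfolding sum3 by (simp add: f_def norm_mult algebra_simps)
    show "min (1 / 2) (\<delta> / (R + 1)) \<le> (\<Sum>i\<in>{0, 1, 2}. cmod (f i s))"
    proof (cases "R \<le> cmod s")
      case True
      have "1 / 2 \<le> cmod (1 + h s)"
        using R(2)[OF s True] norm_triangle_ineq4[of "1 + h s" "h s"] by simp
      moreover have "0 \<le> (cmod (n s) + cmod (d s)) * cmod (z s)" by simp
      ultimately show ?thesis unfolding sum_eq by linarith
    next
      case False
      have "cmod (s + 1) \<le> R + 1" using False norm_triangle_ineq[of s 1] by simp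
      then have "1 / (R + 1) \<le> cmod (z s)"
        unfolding z_def norm_divide using nz[OF s] R(1) by (simp add: frac_le)
      then have "\<delta> * (1 / (R + 1)) \<le> (cmod (n s) + cmod (d s)) * cmod (z s)"
        using lower[OF s] \<delta> R(1) by (intro mult_mono) auto
      then have "\<delta> / (R + 1) \<le> (cmod (n s) + cmod (d s)) * cmod (z s)" by simp
      then show ?thesis unfolding sum_eq using norm_ge_zero[of "1 + h s"] by linarith
    qed
  qed auto
  have ring: "\<alpha> i \<in> A0_AP_plus" if "i \<in> {0, 1, 2}" for i using A0_const_subset[OF \<alpha>(1)[OF that]] .
  have zr: "z \<in> A0_AP_plus" using A0_const_subset[OF A0_subset_A0_const[OF z]] .
  show thesis
  proof (rule that[of "\<lambda>s. \<alpha> 0 s * xA s + z s * \<alpha> 1 s" "\<lambda>s. \<alpha> 0 s * yA s + z s * \<alpha> 2 s"])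
    show "(\<lambda>s. \<alpha> 0 s * xA s + z s * \<alpha> 1 s) \<in> A0_AP_plus" "(\<lambda>s. \<alpha> 0 s * yA s + z s * \<alpha> 2 s) \<in> A0_AP_plus"
      using ring zr AP_plus_subset A by (auto intro!: A0_AP_plus_add A0_AP_plus_mult)
    fix s assume s: "s \<in> closed_rhp"
    have "n s * (\<alpha> 0 s * xA s + z s * \<alpha> 1 s) + d s * (\<alpha> 0 s * yA s + z s * \<alpha> 2 s)
        = (n s * xA s + d s * yA s) * \<alpha> 0 s + n s * z s * \<alpha> 1 s + d s * z s * \<alpha> 2 s"
      by (simp add: algebra_simps)
    also have "\<dots> = (\<Sum>i\<in>{0, 1, 2}. f i s * \<alpha> i s)"
      unfolding sum3 one_h[OF s] by (simp add: f_def)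
    finally show "n s * (\<alpha> 0 s * xA s + z s * \<alpha> 1 s) + d s * (\<alpha> 0 s * yA s + z s * \<alpha> 2 s) = 1"
      using \<alpha>(2)[OF s] by simp
  qed
qed

theorem theorem1p2:
  fixes n d :: "complex \<Rightarrow> complex"
  assumes "n \<in> A0_AP_plus" and "d \<in> A0_AP_plus"
  shows "(\<exists>x\<in>A0_AP_plus. \<exists>y\<in>A0_AP_plus. \<forall>s\<in>closed_rhp. n s * x s + d s * y s = 1) \<longleftrightarrow>
         (\<exists>\<delta>::real. \<delta> > 0 \<and> (\<forall>s\<in>closed_rhp. cmod (n s) + cmod (d s) \<ge> \<delta>))"
proof
  assume "\<exists>x\<in>A0_AP_plus. \<exists>y\<in>A0_AP_plus. \<forall>s\<in>closed_rhp. n s * x s + d s * y s = 1"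
  then obtain x y where xy: "x \<in> A0_AP_plus" "y \<in> A0_AP_plus"
      "\<And>s. s \<in> closed_rhp \<Longrightarrow> n s * x s + d s * y s = 1" by blast
  obtain B where B: "B > 0" "\<And>s. s \<in> closed_rhp \<Longrightarrow> cmod (x s) \<le> B"
    using A0_AP_plus_bounded[OF xy(1)] by metis
  obtain C where C: "C > 0" "\<And>s. s \<in> closed_rhp \<Longrightarrow> cmod (y s) \<le> C"
    using A0_AP_plus_bounded[OF xy(2)] by metis
  have "1 / (B + C) \<le> cmod (n s) + cmod (d s)" if s: "s \<in> closed_rhp" for s
  proof -
    have "1 \<le> cmod (n s * x s) + cmod (d s * y s)"
      using norm_triangle_ineq[of "n s * x s" "d s * y s"] by (simp add: xy(3)[OF s])
    also have "\<dots> \<le> cmod (n s) * (B + C) + cmod (d s) * (B + C)"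
      unfolding norm_mult using B(1) B(2)[OF s] C(1) C(2)[OF s] by (intro add_mono mult_left_mono) auto
    finally have "1 \<le> (cmod (n s) + cmod (d s)) * (B + C)" by (simp add: distrib_right)
    then show ?thesis using B(1) C(1) by (simp add: pos_divide_le_eq)
  qed
  moreover have "1 / (B + C) > 0" using B(1) C(1) by simp
  ultimately show "\<exists>\<delta>::real. \<delta> > 0 \<and> (\<forall>s\<in>closed_rhp. cmod (n s) + cmod (d s) \<ge> \<delta>)" by blast
next
  assume "\<exists>\<delta>::real. \<delta> > 0 \<and> (\<forall>s\<in>closed_rhp. cmod (n s) + cmod (d s) \<ge> \<delta>)"
  then obtain \<delta> where "\<delta> > 0" "\<And>s. s \<in> closed_rhp \<Longrightarrow> \<delta> \<le> cmod (n s) + cmod (d s)" by blast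
  then obtain x y where "x \<in> A0_AP_plus" "y \<in> A0_AP_plus"
      "\<And>s. s \<in> closed_rhp \<Longrightarrow> n s * x s + d s * y s = 1"
    using A0_AP_plus_corona[OF assms] by metis
  then show "\<exists>x\<in>A0_AP_plus. \<exists>y\<in>A0_AP_plus. \<forall>s\<in>closed_rhp. n s * x s + d s * y s = 1" by blast
qed

end
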